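(* Let $\delta>0$ and $\gamma\ge 0$, let $G$ be the inverse Gaussian subordinator with parameters $(\delta,\gamma)$, let $H(t)=\inf\{u>0: G(u)>t\}$, and let $h(x,t)$ be the density function of $H(t)$. Then $h$ satisfies the pseudo-fractional PDE $$\frac{\partial}{\partial x}h(x,t)+\sqrt{2}\,\delta\, \frac{\partial^{1/2,\lambda}}{\partial t^{1/2, \lambda}}h(x,t) = 0,\qquad \lambda = \gamma^2/2 .$$ For $\delta=1$ and $\gamma=0$, the density function $h(x,t)$ satisfies $$\frac{\partial}{\partial x}h(x,t) +\sqrt{2}\left(\frac{\partial}{\partial t}\right)^{1/2}h(x,t) + \sqrt{\frac{2}{\pi t}}\,h(x,0)=0.$$
   Context: Let $B$ be a standard Brownian motion. The inverse Gaussian (IG) subordinator with parameters $(\delta,\gamma)$ is $G(t)=\inf\{s>0: B(s)+\gamma s>\delta t\}$; it is a strictly increasing L\'evy process started at $0$ with $\mathbb{E}\,e^{-sG(x)}=e^{-\delta x(\sqrt{\gamma^2+2s}-\gamma)}$ for $s\ge 0$. Its first-exit time process is $H(t)=\inf\{u>0: G(u)>t\}$, $t\ge 0$, and $h(x,t)$ denotes the density in $x>0$ of $H(t)$. For $0<\beta<1$, the Riemann-Liouville tempered fractional derivative of order $\beta$ is $$\frac{\partial^{\beta,\lambda}}{\partial t^{\beta, \lambda}}g(t) = e^{-\lambda t}\frac{1}{\Gamma(1-\beta)}\frac{d}{dt}\int_{0}^{t}\frac{e^{\lambda s}g(s)}{(t-s)^{\beta}}\,ds - \lambda^{\beta}g(t),$$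 and the Caputo fractional derivative of order $\beta$ is $$\left(\frac{\partial}{\partial t}\right)^{\beta}g(t) = \frac{1}{\Gamma(1-\beta)}\int_{0}^{t}\frac{g'(r)}{(t-r)^{\beta}}\,dr.$$ When applied to $h(x,t)$ these act in the variable $t$. *)

theory Defs
  imports "HOL-Probability.Probability"
begin

definition standard_brownian_motion :: "'a measure \<Rightarrow> (real \<Rightarrow> 'a \<Rightarrow> real) \<Rightarrow> bool" where
  "standard_brownian_motion M B \<longleftrightarrow>
     prob_space M \<and>
     (\<forall>t\<ge>0. B t \<in> borel_measurable M) \<and>
     (AE \<omega> in M. B 0 \<omega> = 0) \<and>
     (AE \<omega> in M. continuous_on {0..} (\<lambda>t. B t \<omega>)) \<and>
     (\<forall>s t. 0 \<le> s \<and> s < t \<longrightarrow>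
        distributed M lborel (\<lambda>\<omega>. B t \<omega> - B s \<omega>) (normal_density 0 (sqrt (t - s)))) \<and>
     (\<forall>(n::nat) (\<tau>::nat \<Rightarrow> real). 0 \<le> \<tau> 0 \<and> (\<forall>i<n. \<tau> i \<le> \<tau> (Suc i)) \<longrightarrow>
        prob_space.indep_vars M (\<lambda>_. borel) (\<lambda>i \<omega>. B (\<tau> (Suc i)) \<omega> - B (\<tau> i) \<omega>) {..<n})"

(* Extended real values implement the convention that the infimum of the empty set
   is infinite; the value infinity occurs only on a null set. *)
definition ig_subordinator ::
    "(real \<Rightarrow> 'a \<Rightarrow> real) \<Rightarrow> real \<Rightarrow> real \<Rightarrow> real \<Rightarrow> 'a \<Rightarrow> ereal" where
  "ig_subordinator B \<delta> \<gamma> t \<omega> = (INF s\<in>{s. s > 0 \<and> B s \<omega> + \<gamma> * s > \<delta> * t}. ereal s)"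

(* The infimum is over a nonempty set of reals whenever the path of the Brownian motion is
   continuous, so it may be taken in the reals. *)
definition first_exit_time :: "(real \<Rightarrow> 'a \<Rightarrow> ereal) \<Rightarrow> real \<Rightarrow> 'a \<Rightarrow> real" where
  "first_exit_time G t \<omega> = Inf {u. u > 0 \<and> G u \<omega> > ereal t}"

(* f is the density on x > 0 of X, in its continuous version; continuity fixes f at every
   point of (0, infinity), which pointwise equations for densities presuppose.
   An atom of X at 0 is permitted: for X = 0 almost surely the density on x > 0 is 0. *)
definition continuous_density_pos :: "'a measure \<Rightarrow> ('a \<Rightarrow> real) \<Rightarrow> (real \<Rightarrow> real) \<Rightarrow> bool" where
  "continuous_density_pos M X f \<longleftrightarrow>
     X \<in> borel_measurable M \<and>
     continuous_on {0<..} f \<and> (\<forall>x>0. f x \<ge> 0) \<and>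
     (\<forall>A\<in>sets borel. A \<subseteq> {0<..} \<longrightarrow>
        emeasure M {\<omega> \<in> space M. X \<omega> \<in> A} = (\<integral>\<^sup>+x\<in>A. ennreal (f x) \<partial>lborel))"

definition tempered_RL_integral :: "real \<Rightarrow> real \<Rightarrow> (real \<Rightarrow> real) \<Rightarrow> real \<Rightarrow> real" where
  "tempered_RL_integral \<beta> lam g t = (LBINT s:{0<..<t}. exp (lam * s) * g s / (t - s) powr \<beta>)"

definition tempered_RL_deriv :: "real \<Rightarrow> real \<Rightarrow> (real \<Rightarrow> real) \<Rightarrow> real \<Rightarrow> real" where
  "tempered_RL_deriv \<beta> lam g t =
     exp (- lam * t) * (1 / Gamma (1 - \<beta>)) * deriv (tempered_RL_integral \<beta> lam g) t
       - lam powr \<beta> * g t"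

(* The next predicate and caputo_differentiable state that the integrals and derivatives in
   the respective formulas exist, since deriv and the Lebesgue integral are total functions. *)
definition tempered_RL_differentiable :: "real \<Rightarrow> real \<Rightarrow> (real \<Rightarrow> real) \<Rightarrow> real \<Rightarrow> bool" where
  "tempered_RL_differentiable \<beta> lam g t \<longleftrightarrow>
     (\<forall>\<^sub>F \<tau> in nhds t.
        set_integrable lborel {0<..<\<tau>} (\<lambda>s. exp (lam * s) * g s / (\<tau> - s) powr \<beta>)) \<and>
     tempered_RL_integral \<beta> lam g differentiable at t"

definition caputo_deriv :: "real \<Rightarrow> (real \<Rightarrow> real) \<Rightarrow> real \<Rightarrow> real" where
  "caputo_deriv \<beta> g t =
     1 / Gamma (1 - \<beta>) * (LBINT r:{0<..<t}. deriv g r / (t - r) powr \<beta>)"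

definition caputo_differentiable :: "real \<Rightarrow> (real \<Rightarrow> real) \<Rightarrow> real \<Rightarrow> bool" where
  "caputo_differentiable \<beta> g t \<longleftrightarrow>
     continuous_on {0..t} g \<and>
     (\<forall>r\<in>{0<..<t}. g differentiable at r) \<and>
     set_integrable lborel {0<..<t} (\<lambda>r. deriv g r / (t - r) powr \<beta>)"

end

theory Submission
  imports Defs
begin

text \<open>
  Write \<open>X s = B s + \<gamma> s\<close>. Since \<open>G u\<close> is the first time at which \<open>X\<close> exceeds \<open>\<delta> u\<close>,
  continuity of the paths gives \<open>H t \<le> x\<close> exactly when \<open>X\<close> does not exceed \<open>\<delta> x\<close> on \<open>[0, t]\<close>
  (\<open>first_exit_time_le_iff\<close>). So \<open>\<delta> H t\<close> is the running maximum of a Brownian motion with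
  drift, and the first task is to find its law from independence and normality of the increments
  alone.

  The law is
  \<open>F t a = \<Phi> ((a - \<gamma> t) / sqrt t) - exp (2 \<gamma> a) \<Phi> (- (a + \<gamma> t) / sqrt t)\<close>, and a martingale argument
  shows it. On the whole real line, \<open>F\<close> is transported
  by the transition kernel of \<open>X\<close> (\<open>max_cdf_semigroup\<close>), it vanishes at \<open>a = 0\<close>, and as \<open>t\<close> tends
  to 0 it tends to 1 for \<open>a > 0\<close>. Hence \<open>F (t + \<epsilon> - s) (a - X s)\<close>, sampled on a grid of \<open>[0, t]\<close>,
  is a martingale, and stopping it when \<open>X\<close> first exceeds \<open>a\<close> on the grid preserves the expectation
  \<open>F (t + \<epsilon>) a\<close>. As the mesh tends to 0, a path that crosses \<open>a\<close> is stopped with vanishing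
  overshoot, where \<open>F\<close> is almost 0; the other paths contribute \<open>F \<epsilon> (a - X t)\<close>. Letting \<open>\<epsilon>\<close> tend
  to 0 as well leaves the probability that \<open>X\<close> stays below \<open>a\<close> (\<open>drifted_brownian_max_cdf\<close>). The
  shift by \<open>\<epsilon>\<close> keeps the time argument of \<open>F\<close> away from 0, which makes \<open>F\<close> Lipschitz near \<open>a = 0\<close>.
  A continuous density is the derivative of the distribution function, so
  \<open>h x t = \<delta> f t (\<delta> x)\<close> with \<open>f = dF/da\<close> for \<open>t > 0\<close>, and \<open>h x 0 = 0\<close> (\<open>exit_time_density\<close>).

  What remains is calculus with the heat kernel \<open>K\<close> and the weighted tail
  \<open>W t a = \<integral> exp (- \<gamma> c) K t (a + c) dc\<close> over \<open>c \<ge> 0\<close>. Up to an exponential factor, \<open>f\<close> is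
  \<open>2 K - 2 \<gamma> W\<close>, which is twice a mixture over \<open>c \<ge> 0\<close> of the first-passage densities
  \<open>(b / s) K s b\<close> at levels \<open>b = a + c\<close>. The fractional integral of order 1/2 in time turns a
  first-passage density into \<open>sqrt 2\<close> times the heat kernel at the same level
  (\<open>passage_density_half_integral\<close>), so by Tonelli it turns the mixture into \<open>W\<close>
  (\<open>tempered_half_integral\<close>). Both sides of the tempered equation are then explicit combinations
  of \<open>K\<close> and \<open>W\<close>, because \<open>dW/da = \<gamma> W - K\<close> and \<open>dW/dt = (\<gamma>\<^sup>2 / 2) W + (a / t - \<gamma>) / 2 K\<close>. For
  \<open>\<gamma> = 0\<close> the time derivative of \<open>K\<close> is itself a combination of the first-passage density
  at level \<open>a\<close> and the same density divided by the time, which gives the Caputo equation (\<open>caputo_deriv_heat_kernel\<close>).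
\<close>


section \<open>The normal distribution function\<close>

definition Phi :: "real \<Rightarrow> real" where
  "Phi = cdf std_normal_distribution"

lemma Phi_nonneg: "0 \<le> Phi x"
  by (simp add: Phi_def cdf_def)

lemma Phi_le_1: "Phi x \<le> 1"
  unfolding Phi_def by (rule real_distribution.cdf_bounded_prob[OF real_dist_normal_dist])

lemma Phi_at_top: "(Phi \<longlongrightarrow> 1) at_top"
  unfolding Phi_def by (rule real_distribution.cdf_lim_at_top_prob[OF real_dist_normal_dist])

lemma Phi_at_bot: "(Phi \<longlongrightarrow> 0) at_bot"
proof -
  interpret real_distribution std_normal_distribution by (rule real_dist_normal_dist)
  show ?thesis unfolding Phi_def by (rule cdf_lim_at_bot)
qed

lemma set_integrable_std_normal_density:
  "A \<in> sets borel \<Longrightarrow> set_integrable lborel A std_normal_density"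
  unfolding set_integrable_def by (intro integrable_mult_indicator) auto

lemma Phi_eq_integral: "Phi x = (LBINT z:{..x}. std_normal_density z)"
proof -
  have "emeasure std_normal_distribution {..x} = (\<integral>\<^sup>+z. ennreal (indicator {..x} z * std_normal_density z) \<partial>lborel)"
    by (subst emeasure_density) (auto intro!: nn_integral_cong simp: indicator_def)
  also have "\<dots> = ennreal (\<integral>z. indicator {..x} z * std_normal_density z \<partial>lborel)"
    using set_integrable_std_normal_density[of "{..x}"]
    by (intro nn_integral_eq_integral) (auto simp: set_integrable_def)
  finally show ?thesis
    by (simp add: Phi_def cdf_def measure_def set_lebesgue_integral_def Bochner_Integration.integral_nonneg)
qed

lemma Phi_has_real_derivative [derivative_intros]:
  assumes "(g has_real_derivative g') (at x within S)"
  shows "((\<lambda>x. Phi (g x)) has_real_derivative std_normal_density (g x) * g') (at x within S)"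
proof -
  have "(Phi has_real_derivative std_normal_density y) (at y)" for y :: real
  proof -
    have cont: "continuous_on A std_normal_density" for A
      unfolding std_normal_density_def by (intro continuous_intros) auto
    have "((\<lambda>u. integral {y - 1..u} std_normal_density) has_real_derivative std_normal_density y)
            (at y within {y - 1..y + 1})"
      by (rule integral_has_real_derivative[OF cont]) auto
    then have "((\<lambda>u. Phi (y - 1) + integral {y - 1..u} std_normal_density) has_real_derivative std_normal_density y)
            (at y within {y - 1..y + 1})"
      by (auto intro!: derivative_eq_intros)
    note D = this
    have eq: "Phi (y - 1) + integral {y - 1..u} std_normal_density = Phi u" if "u \<in> {y - 1..y + 1}" for u
    proof -
      have "{..u} = {..y - 1} \<union> {y - 1<..u}"
        using that by auto
      then have "Phi u = (LBINT z:{..y - 1} \<union> {y - 1<..u}. std_normal_density z)"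
        unfolding Phi_eq_integral by (rule arg_cong)
      also have "\<dots> = Phi (y - 1) + (LBINT z:{y - 1<..u}. std_normal_density z)"
        unfolding Phi_eq_integral by (intro set_integral_Un set_integrable_std_normal_density) auto
      also have "(LBINT z:{y - 1<..u}. std_normal_density z) = (LBINT z:{y - 1..u}. std_normal_density z)"
        unfolding set_lebesgue_integral_def 
        by (intro integral_cong_AE eventually_mono[OF AE_lborel_singleton[of "y - 1"]]) (auto simp: indicator_def)
      also have "\<dots> = integral {y - 1..u} std_normal_density"
        by (intro set_borel_integral_eq_integral set_integrable_std_normal_density) auto
      finally show ?thesis by simp
    qed
    have "(Phi has_real_derivative std_normal_density y) (at y within {y - 1..y + 1})"
      by (rule has_field_derivative_transform_within[OF D zero_less_one]) (auto simp: eq)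
    then show ?thesis
      by (simp add: at_within_Icc_at)
  qed
  from DERIV_chain2[OF this assms] show ?thesis .
qed

lemma tendsto_Phi [tendsto_intros]:
  "(g \<longlongrightarrow> a) F \<Longrightarrow> ((\<lambda>x. Phi (g x)) \<longlongrightarrow> Phi a) F"
  by (rule isCont_tendsto_compose[OF DERIV_isCont[OF Phi_has_real_derivative[OF DERIV_ident]]])

lemma continuous_on_Phi [continuous_intros]:
  "continuous_on S g \<Longrightarrow> continuous_on S (\<lambda>x. Phi (g x))"
  unfolding continuous_on_def by (blast intro: tendsto_Phi)

lemma borel_measurable_Phi [measurable]: "Phi \<in> borel_measurable borel"
  using continuous_on_Phi[OF continuous_on_id] by (intro borel_measurable_continuous_onI) simp

lemma Phi_0: "Phi 0 = 1 / 2"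
proof -
  have "1 = (LBINT z:{..0} \<union> {0<..}. std_normal_density z)"
  proof -
    have "{..0} \<union> {0<..} = (UNIV::real set)" by auto
    then show ?thesis
      by (simp add: set_lebesgue_integral_def)
  qed
  also have "\<dots> = Phi 0 + (LBINT z:{0<..}. std_normal_density z)"
    unfolding Phi_eq_integral by (intro set_integral_Un set_integrable_std_normal_density) auto
  also have "(LBINT z:{0<..}. std_normal_density z) = (LBINT z:{..<0}. std_normal_density z)"
    unfolding set_lebesgue_integral_def
    by (subst lborel_integral_real_affine[where c="-1" and t=0])
       (auto intro!: Bochner_Integration.integral_cong simp: indicator_def std_normal_density_def)
  also have "\<dots> = Phi 0"
    unfolding set_lebesgue_integral_def Phi_eq_integral 
    by (intro integral_cong_AE eventually_mono[OF AE_lborel_singleton[of 0]]) (auto simp: indicator_def)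
  finally show ?thesis by simp
qed

section \<open>The heat kernel, its tail, and the law of the maximum\<close>

definition heat_kernel :: "real \<Rightarrow> real \<Rightarrow> real" where
  "heat_kernel t a = exp (- a\<^sup>2 / (2 * t)) / sqrt (2 * pi * t)"

text \<open>For \<open>t > 0\<close> and \<open>\<gamma> \<ge> 0\<close> this is the integral of \<open>exp (- \<gamma> c) * heat_kernel t (a + c)\<close> over
\<open>c \<ge> 0\<close>, in the closed form that completing the square gives; see \<open>heat_tail_eq_integral\<close>.\<close>

definition heat_tail :: "real \<Rightarrow> real \<Rightarrow> real \<Rightarrow> real" where
  "heat_tail \<gamma> t a = exp (\<gamma>\<^sup>2 * t / 2 + \<gamma> * a) * Phi (- (a + \<gamma> * t) / sqrt t)"

text \<open>Here \<open>a\<close> ranges over the whole real line. For \<open>a > 0\<close> it will be the probability that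
a Brownian motion with drift \<open>\<gamma>\<close> stays below \<open>a\<close> up to time \<open>t\<close>; to \<open>a < 0\<close> it continues that
probability so that \<open>exp (- \<gamma> * a) * max_cdf \<gamma> t a\<close> is odd in \<open>a\<close>. The negative values there
compensate for the paths that have crossed the barrier.\<close>

definition max_cdf :: "real \<Rightarrow> real \<Rightarrow> real \<Rightarrow> real" where
  "max_cdf \<gamma> t a = Phi ((a - \<gamma> * t) / sqrt t) - exp (2 * \<gamma> * a) * Phi (- (a + \<gamma> * t) / sqrt t)"

text \<open>The derivative of \<open>max_cdf\<close> in \<open>a\<close>, arranged so that all dependence on \<open>t\<close> and \<open>a\<close> other than the
exponential factor goes through \<open>heat_kernel\<close> and \<open>heat_tail\<close>, on which differentiation acts
linearly.\<close>

definition max_density :: "real \<Rightarrow> real \<Rightarrow> real \<Rightarrow> real" where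
  "max_density \<gamma> t a = exp (\<gamma> * a - \<gamma>\<^sup>2 * t / 2) * (2 * heat_kernel t a - 2 * \<gamma> * heat_tail \<gamma> t a)"

lemma heat_kernel_pos: "t > 0 \<Longrightarrow> 0 < heat_kernel t a"
  by (simp add: heat_kernel_def)

lemma heat_tail_nonneg: "0 \<le> heat_tail \<gamma> t a"
  by (simp add: heat_tail_def Phi_nonneg)

text \<open>The Cameron-Martin factor: shifting the Gaussian by the drift multiplies it by an exponential.\<close>

lemma std_normal_density_drift:
  assumes "t > 0"
  shows "std_normal_density ((a - \<gamma> * t) / sqrt t) = sqrt t * exp (\<gamma> * a - \<gamma>\<^sup>2 * t / 2) * heat_kernel t a"
proof -
  have "- (((a - \<gamma> * t) / sqrt t)\<^sup>2) / 2 = (\<gamma> * a - \<gamma>\<^sup>2 * t / 2) + - a\<^sup>2 / (2 * t)"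
    using assms by (simp add: power_divide field_simps power2_eq_square)
  then show ?thesis
    using assms unfolding std_normal_density_def heat_kernel_def
    by (simp only: exp_add) (simp add: real_sqrt_mult)
qed

lemma std_normal_density_drift':
  assumes "t > 0"
  shows "std_normal_density (- (a + \<gamma> * t) / sqrt t) = sqrt t * exp (- \<gamma> * a - \<gamma>\<^sup>2 * t / 2) * heat_kernel t a"
  using std_normal_density_drift[OF assms, of a "-\<gamma>"]
  by (simp add: std_normal_density_def power_divide power2_commute[of "- a"] power2_eq_square algebra_simps)

lemma heat_kernel_deriv_space:
  assumes "t > 0"
  shows "((\<lambda>a. heat_kernel t a) has_real_derivative - (a / t) * heat_kernel t a) (at a)"
  unfolding heat_kernel_def using assms by (auto intro!: derivative_eq_intros simp: field_simps)

lemma heat_kernel_deriv_time: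
  assumes "t > 0"
  shows "((\<lambda>t. heat_kernel t a) has_real_derivative (a\<^sup>2 / t\<^sup>2 - 1 / t) / 2 * heat_kernel t a) (at t)"
proof -
  have s: "x / sqrt (2 * pi * t) = x * sqrt (2 * pi * t) / (2 * pi * t)"
    "inverse (sqrt (2 * pi * t)) = sqrt (2 * pi * t) / (2 * pi * t)" for x
    using assms by (simp_all add: field_simps)
  have D: "((\<lambda>t. heat_kernel t a) has_real_derivative
      (exp (- (a\<^sup>2 / (2 * t))) * a\<^sup>2 * sqrt (2 * pi * t) / (2 * (t * t)) -
       exp (- (a\<^sup>2 / (2 * t))) * (inverse (sqrt (2 * pi * t)) * pi)) / (2 * pi * t)) (at t)"
    unfolding heat_kernel_def using assms
    by (auto intro!: derivative_eq_intros simp: mult_less_0_iff)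
  show ?thesis
    by (rule DERIV_cong[OF D], unfold s heat_kernel_def) (use assms in \<open>simp add: field_simps power2_eq_square\<close>)
qed

lemma heat_tail_weight_mult_density:
  assumes "t > 0"
  shows "exp (\<gamma>\<^sup>2 * t / 2 + \<gamma> * a) * std_normal_density (- (a + \<gamma> * t) / sqrt t) = sqrt t * heat_kernel t a"
proof -
  have "exp (\<gamma>\<^sup>2 * t / 2 + \<gamma> * a) * exp (- \<gamma> * a - \<gamma>\<^sup>2 * t / 2) = 1"
    by (simp add: exp_add[symmetric])
  then show ?thesis
    using assms by (simp only: std_normal_density_drift') (simp add: algebra_simps)
qed

text \<open>Differentiation along an arbitrary curve \<open>(b, a)\<close> of times and levels, so that the derivatives in
space and in time become instances. Differentiating \<open>Phi\<close> produces a Gaussian which the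
exponential weight turns into the heat kernel.\<close>

lemma heat_tail_deriv:
  assumes "t > 0" and g: "((\<lambda>x. - (a x + \<gamma> * b x) / sqrt (b x)) has_real_derivative d) (at x)"
    and e: "((\<lambda>x. \<gamma>\<^sup>2 * b x / 2 + \<gamma> * a x) has_real_derivative e) (at x)" and "b x = t" "a x = y"
  shows "((\<lambda>x. heat_tail \<gamma> (b x) (a x)) has_real_derivative e * heat_tail \<gamma> t y + d * sqrt t * heat_kernel t y) (at x)"
proof -
  have "((\<lambda>x. heat_tail \<gamma> (b x) (a x)) has_real_derivative
     exp (\<gamma>\<^sup>2 * t / 2 + \<gamma> * y) * (std_normal_density (- (y + \<gamma> * t) / sqrt t) * d) +
     exp (\<gamma>\<^sup>2 * t / 2 + \<gamma> * y) * e * Phi (- (y + \<gamma> * t) / sqrt t)) (at x)"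
    unfolding heat_tail_def using DERIV_mult'[OF DERIV_fun_exp[OF e] Phi_has_real_derivative[OF g]] assms(4,5) by simp
  then show ?thesis
    unfolding mult.assoc[symmetric] heat_tail_weight_mult_density[OF assms(1)]
    by (simp add: heat_tail_def algebra_simps)
qed

lemma heat_tail_deriv_space:
  assumes "t > 0"
  shows "((\<lambda>a. heat_tail \<gamma> t a) has_real_derivative \<gamma> * heat_tail \<gamma> t a - heat_kernel t a) (at a)"
proof -
  have "((\<lambda>a. - (a + \<gamma> * t) / sqrt t) has_real_derivative - 1 / sqrt t) (at a)"
    using assms by (auto intro!: derivative_eq_intros simp: field_simps)
  moreover have "((\<lambda>a. \<gamma>\<^sup>2 * t / 2 + \<gamma> * a) has_real_derivative \<gamma>) (at a)"
    by (auto intro!: derivative_eq_intros)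
  ultimately show ?thesis
    using heat_tail_deriv[OF assms, of "\<lambda>a. a" \<gamma> "\<lambda>_. t" "- 1 / sqrt t" a \<gamma> a] assms by simp
qed

lemma heat_tail_deriv_time:
  assumes "t > 0"
  shows "((\<lambda>t. heat_tail \<gamma> t a) has_real_derivative \<gamma>\<^sup>2 / 2 * heat_tail \<gamma> t a + (a / t - \<gamma>) / 2 * heat_kernel t a) (at t)"
proof -
  have "((\<lambda>t. - (a + \<gamma> * t) / sqrt t) has_real_derivative (a / t - \<gamma>) / (2 * sqrt t)) (at t)"
    using assms by (auto intro!: derivative_eq_intros simp: field_simps)
  moreover have "((\<lambda>t. \<gamma>\<^sup>2 * t / 2 + \<gamma> * a) has_real_derivative \<gamma>\<^sup>2 / 2) (at t)"
    by (auto intro!: derivative_eq_intros)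
  ultimately show ?thesis
    using heat_tail_deriv[OF assms, of "\<lambda>_. a" \<gamma> "\<lambda>t. t" "(a / t - \<gamma>) / (2 * sqrt t)" t "\<gamma>\<^sup>2 / 2" a] assms by simp
qed

lemma heat_tail_at_top:
  assumes "t > 0" "\<gamma> \<ge> 0"
  shows "((\<lambda>c. exp (- \<gamma> * c) * heat_tail \<gamma> t (a + c)) \<longlongrightarrow> 0) at_top"
proof -
  have "filterlim (\<lambda>c. - (a + c + \<gamma> * t) / sqrt t) at_bot at_top"
    using assms by real_asymp
  from tendsto_mult_right_zero[OF filterlim_compose[OF Phi_at_bot this], of "exp (\<gamma>\<^sup>2 * t / 2 + \<gamma> * a)"]
  moreover have "exp (\<gamma>\<^sup>2 * t / 2 + \<gamma> * a) * p = exp (- \<gamma> * c) * (exp (\<gamma>\<^sup>2 * t / 2 + \<gamma> * (a + c)) * p)" for c p :: real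
    by (simp add: mult.assoc[symmetric] exp_add[symmetric] del: mult_cancel_right) (simp add: algebra_simps)
  ultimately show ?thesis
    unfolding heat_tail_def by (simp only: add.assoc[symmetric])
qed

lemma max_cdf_deriv:
  assumes "t > 0"
  shows "((\<lambda>a. max_cdf \<gamma> t a) has_real_derivative max_density \<gamma> t a) (at a)"
proof -
  have "((\<lambda>a. (a - \<gamma> * t) / sqrt t) has_real_derivative 1 / sqrt t) (at a)"
    using assms by (auto intro!: derivative_eq_intros simp: field_simps)
  note [derivative_intros] = Phi_has_real_derivative[OF this]
  have F: "max_cdf \<gamma> t a = Phi ((a - \<gamma> * t) / sqrt t) - exp (\<gamma> * a - \<gamma>\<^sup>2 * t / 2) * heat_tail \<gamma> t a" for a
    by (simp add: max_cdf_def heat_tail_def exp_add[symmetric] algebra_simps)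
  have 1: "std_normal_density ((a - \<gamma> * t) / sqrt t) * (1 / sqrt t) = exp (\<gamma> * a - \<gamma>\<^sup>2 * t / 2) * heat_kernel t a"
    using assms by (simp only: std_normal_density_drift) simp
  have "((\<lambda>a. max_cdf \<gamma> t a) has_real_derivative std_normal_density ((a - \<gamma> * t) / sqrt t) * (1 / sqrt t)
      - (\<gamma> * exp (\<gamma> * a - \<gamma>\<^sup>2 * t / 2) * heat_tail \<gamma> t a + exp (\<gamma> * a - \<gamma>\<^sup>2 * t / 2) * (\<gamma> * heat_tail \<gamma> t a - heat_kernel t a))) (at a)"
    unfolding F using assms
    by (auto intro!: derivative_eq_intros heat_tail_deriv_space)
  then show ?thesis unfolding 1 by (simp add: max_density_def algebra_simps)
qed

text \<open>The right-hand side is the form in which the half-order time derivative of the density reappears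
in \<open>tempered_RL_deriv_max_density\<close>.\<close>

lemma max_density_deriv:
  assumes "t > 0"
  shows "((\<lambda>a. max_density \<gamma> t a) has_real_derivative
     exp (\<gamma> * a - \<gamma>\<^sup>2 * t / 2) * (4 * \<gamma> * heat_kernel t a - 4 * \<gamma>\<^sup>2 * heat_tail \<gamma> t a - 2 * (a / t) * heat_kernel t a)) (at a)"
  unfolding max_density_def using assms
  by (auto intro!: derivative_eq_intros heat_kernel_deriv_space heat_tail_deriv_space simp: algebra_simps power2_eq_square)


section \<open>First-passage densities and their mixtures\<close>

text \<open>The density in \<open>s\<close> of the time at which a driftless Brownian motion first reaches the level \<open>b > 0\<close>;
also minus the spatial derivative of the heat kernel.\<close>

definition passage_density :: "real \<Rightarrow> real \<Rightarrow> real" where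
  "passage_density s b = b / s * heat_kernel s b"

lemma passage_density_nonneg: "s > 0 \<Longrightarrow> b \<ge> 0 \<Longrightarrow> 0 \<le> passage_density s b"
  using heat_kernel_pos[of s b] by (simp add: passage_density_def)

lemma measurable_heat_functions [measurable (raw)]:
  assumes [measurable]: "p \<in> borel_measurable M" "q \<in> borel_measurable M"
  shows "(\<lambda>x. heat_kernel (p x) (q x)) \<in> borel_measurable M"
    "(\<lambda>x. passage_density (p x) (q x)) \<in> borel_measurable M"
    "(\<lambda>x. heat_tail c (p x) (q x)) \<in> borel_measurable M"
    "(\<lambda>x. max_cdf c (p x) (q x)) \<in> borel_measurable M"
    "(\<lambda>x. max_density c (p x) (q x)) \<in> borel_measurable M"
  unfolding heat_kernel_def passage_density_def heat_tail_def max_cdf_def max_density_def by measurable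

lemma heat_tail_eq_integral:
  assumes "t > 0" "\<gamma> \<ge> 0"
  shows "(\<integral>\<^sup>+c. ennreal (exp (- \<gamma> * c) * heat_kernel t (a + c)) * indicator {0..} c \<partial>lborel) = ennreal (heat_tail \<gamma> t a)"
proof -
  have D: "((\<lambda>c. - (exp (- \<gamma> * c) * heat_tail \<gamma> t (a + c))) has_real_derivative
      exp (- \<gamma> * c) * heat_kernel t (a + c)) (at c)" for c
    by (rule derivative_eq_intros DERIV_chain2[OF heat_tail_deriv_space[OF assms(1)]] refl)+
       (simp add: algebra_simps)
  show ?thesis
    by (subst nn_integral_FTC_atLeast[OF _ D])
       (use tendsto_minus[OF heat_tail_at_top[OF assms]] heat_kernel_pos[OF assms(1), THEN less_imp_le] in auto)
qed

lemma passage_density_antiderivative: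
  assumes "t > 0"
  shows "((\<lambda>c. \<gamma> * (exp (- \<gamma> * c) * heat_tail \<gamma> t (a + c)) - exp (- \<gamma> * c) * heat_kernel t (a + c)) has_real_derivative
      exp (- \<gamma> * c) * passage_density t (a + c)) (at c)"
  by (rule derivative_eq_intros DERIV_chain2[OF heat_tail_deriv_space[OF assms(1)]]
         DERIV_chain2[OF heat_kernel_deriv_space[OF assms(1)]] refl)+
     (simp add: algebra_simps passage_density_def)

lemma passage_density_antiderivative_at_top:
  assumes "t > 0" "\<gamma> \<ge> 0"
  shows "((\<lambda>c. \<gamma> * (exp (- \<gamma> * c) * heat_tail \<gamma> t (a + c)) - exp (- \<gamma> * c) * heat_kernel t (a + c)) \<longlongrightarrow> 0) at_top"
proof -
  have "((\<lambda>c. exp (- \<gamma> * c) * heat_kernel t (a + c)) \<longlongrightarrow> 0) at_top"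
  proof (rule tendsto_sandwich[where f="\<lambda>_. 0"])
    show "((\<lambda>c. heat_kernel t (a + c)) \<longlongrightarrow> 0) at_top"
      unfolding heat_kernel_def using assms(1) by real_asymp
    show "\<forall>\<^sub>F c in at_top. exp (- \<gamma> * c) * heat_kernel t (a + c) \<le> heat_kernel t (a + c)"
      using eventually_ge_at_top[of 0] by eventually_elim
        (use assms heat_kernel_pos[OF assms(1), THEN less_imp_le] in \<open>auto intro!: mult_left_le_one_le\<close>)
    show "\<forall>\<^sub>F c in at_top. 0 \<le> exp (- \<gamma> * c) * heat_kernel t (a + c)"
      using heat_kernel_pos[OF assms(1), THEN less_imp_le] by simp
  qed simp
  from tendsto_diff[OF tendsto_mult_right_zero[OF heat_tail_at_top[OF assms(1,2)], of \<gamma> a] this]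
  show ?thesis by simp
qed

text \<open>Integration by parts in \<open>c\<close>, since \<open>passage_density\<close> is minus the spatial derivative of the heat
kernel. This writes the density of the maximum as a mixture of first-passage densities: the reason
why it is nonnegative, and the reason why its half-order integral is computable.\<close>

lemma passage_density_integral:
  assumes "t > 0" "\<gamma> \<ge> 0" "a \<ge> 0"
  shows "(\<integral>\<^sup>+c. ennreal (exp (- \<gamma> * c) * passage_density t (a + c)) * indicator {0..} c \<partial>lborel) =
    ennreal (heat_kernel t a - \<gamma> * heat_tail \<gamma> t a)"
  by (subst nn_integral_FTC_atLeast[OF _ passage_density_antiderivative[OF assms(1)] _ passage_density_antiderivative_at_top[OF assms(1,2)]])
     (use assms passage_density_nonneg in auto)

lemma heat_tail_le_heat_kernel:
  assumes "t > 0" "\<gamma> \<ge> 0" "a \<ge> 0"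
  shows "\<gamma> * heat_tail \<gamma> t a \<le> heat_kernel t a"
proof -
  let ?P = "\<lambda>c. \<gamma> * (exp (- \<gamma> * c) * heat_tail \<gamma> t (a + c)) - exp (- \<gamma> * c) * heat_kernel t (a + c)"
  have "?P 0 \<le> ?P c" if "c \<ge> 0" for c
  proof (rule DERIV_nonneg_imp_nondecreasing[OF that])
    fix x :: real assume "0 \<le> x"
    then have "0 \<le> exp (- \<gamma> * x) * passage_density t (a + x)"
      using assms passage_density_nonneg by simp
    with passage_density_antiderivative[OF assms(1)]
    show "\<exists>y. (?P has_real_derivative y) (at x) \<and> 0 \<le> y" by blast
  qed
  then have "?P 0 \<le> 0"
    by (intro tendsto_lowerbound[OF passage_density_antiderivative_at_top[OF assms(1,2)]])
       (auto intro: eventually_mono[OF eventually_ge_at_top[of 0]])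
  then show ?thesis by simp
qed

lemma max_density_nonneg:
  assumes "t > 0" "\<gamma> \<ge> 0" "a \<ge> 0"
  shows "0 \<le> max_density \<gamma> t a"
  using heat_tail_le_heat_kernel[OF assms] by (simp add: max_density_def)

section \<open>Half-order integrals in time\<close>

text \<open>The substitution \<open>v = b * sqrt (1/s - 1/t)\<close>. It maps \<open>s\<close> in \<open>(0, t)\<close> to \<open>v\<close> in \<open>(0, \<infinity>)\<close>, and since
\<open>b\<^sup>2 / (2 s) = b\<^sup>2 / (2 t) + v\<^sup>2 / 2\<close> it splits the exponential into the heat kernel at time \<open>t\<close> and
a Gaussian in \<open>v\<close>; the singular factors cancel against the Jacobian. The weight \<open>m\<close> is free
so that \<open>m v = 1\<close> serves the Riemann-Liouville and \<open>m v = 1/t + v\<^sup>2/b\<^sup>2\<close>, which is \<open>1/s\<close>, the Caputo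
derivative.\<close>

lemma half_integral_substitution:
  fixes P m :: "real \<Rightarrow> real"
  assumes "t > 0" "b > 0"
    and P: "\<And>v. v > 0 \<Longrightarrow> (P has_real_derivative - (m v * std_normal_density v)) (at v)"
    and m: "continuous_on UNIV m" "\<And>v. m v \<ge> 0"
    and lim: "(P \<longlongrightarrow> P\<^sub>0) (at_right 0)" "(P \<longlongrightarrow> 0) at_top"
  defines "v \<equiv> \<lambda>s. b * sqrt (1 / s - 1 / t)"
  shows "set_integrable lborel {0<..<t} (\<lambda>s. m (v s) * passage_density s b / (t - s) powr (1/2))"
    and "(LBINT s:{0<..<t}. m (v s) * passage_density s b / (t - s) powr (1/2)) = 2 * P\<^sub>0 * sqrt (2 * pi) * heat_kernel t b"
proof -
  \<comment> \<open>The Gaussian \<open>exp (- b\<^sup>2 / (2 t))\<close> that the substitution splits off, with the constants left over from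
    the Jacobian; \<open>C * P (v s)\<close> is then an antiderivative of the integrand.\<close>
  define C where "C = 2 * sqrt (2 * pi) * heat_kernel t b"
  have v': "(v has_real_derivative - b / (2 * s\<^sup>2 * sqrt (1 / s - 1 / t))) (at s)" if "0 < s" "s < t" for s
    unfolding v_def using that assms(1,2)
    by (auto intro!: derivative_eq_intros simp: field_simps power2_eq_square)
  have v_pos: "0 < v s" if "0 < s" "s < t" for s
    unfolding v_def using that assms(1,2) by (simp add: field_simps)
  have eq: "C * (std_normal_density (v s) * (b / (2 * s\<^sup>2 * sqrt (1 / s - 1 / t)))) = passage_density s b / (t - s) powr (1/2)"
    if s: "0 < s" "s < t" for s
  proof -
    have "- (v s)\<^sup>2 / 2 = b\<^sup>2 / (2 * t) + - b\<^sup>2 / (2 * s)"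
      using s assms(1,2) by (simp add: v_def power_mult_distrib field_simps)
    then have sd: "std_normal_density (v s) = exp (b\<^sup>2 / (2 * t)) * exp (- b\<^sup>2 / (2 * s)) / sqrt (2 * pi)"
      unfolding std_normal_density_def by (simp only: exp_add) simp
    have sq: "sqrt (1 / s - 1 / t) = sqrt (t - s) / (sqrt s * sqrt t)"
      using s assms(1,2) by (simp add: real_sqrt_divide[symmetric] real_sqrt_mult[symmetric] field_simps)
    have ex: "exp (- b\<^sup>2 / (2 * t)) = 1 / exp (b\<^sup>2 / (2 * t))"
      by (simp add: exp_minus inverse_eq_divide)
    have alg: "2 * q * (1 / E / (q * T)) * (E * X / q * (b / (2 * s\<^sup>2 * (R / (S * T))))) = b / s * (X / (q * S)) / R"
      if "q > 0" "E > 0" "T > 0" "R > 0" "S > 0" "S * S = s" for q E T R S X :: real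
      using that s by (simp add: field_simps power2_eq_square)
    have "(t - s) powr (1/2) = sqrt (t - s)" "sqrt (2 * pi * r) = sqrt (2 * pi) * sqrt r" for r
      using s by (simp_all add: powr_half_sqrt real_sqrt_mult)
    then show ?thesis
      unfolding C_def passage_density_def heat_kernel_def sd sq ex
      using alg[of "sqrt (2 * pi)" "exp (b\<^sup>2 / (2 * t))" "sqrt t" "sqrt (t - s)" "sqrt s" "exp (- b\<^sup>2 / (2 * s))"] s
      by (simp only:) simp
  qed
  let ?g = "\<lambda>s. m (v s) * passage_density s b / (t - s) powr (1/2)"
  have D: "((\<lambda>s. C * P (v s)) has_real_derivative ?g s) (at s)" if s: "0 < s" "s < t" for s
  proof -
    have "((\<lambda>s. C * P (v s)) has_real_derivative C * (- (m (v s) * std_normal_density (v s)) * (- b / (2 * s\<^sup>2 * sqrt (1 / s - 1 / t))))) (at s)"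
      by (intro DERIV_cmult DERIV_chain2[OF P v'] v_pos s)
    also have "C * (- (m (v s) * std_normal_density (v s)) * (- b / (2 * s\<^sup>2 * sqrt (1 / s - 1 / t)))) =
       m (v s) * (C * (std_normal_density (v s) * (b / (2 * s\<^sup>2 * sqrt (1 / s - 1 / t)))))"
      by (simp add: algebra_simps)
    finally show ?thesis unfolding eq[OF s] by simp
  qed
  have "continuous_on {0<..<t} ?g"
    unfolding passage_density_def heat_kernel_def v_def using assms(1,2)
    by (intro continuous_intros continuous_on_compose2[OF m(1)]) auto
  then have cont: "isCont ?g s" if "0 < s" "s < t" for s
    using that by (simp add: continuous_on_eq_continuous_at)
  have v0: "filterlim v at_top (at_right 0)"
    unfolding v_def using assms(1,2) by real_asymp
  have "\<forall>\<^sub>F s in at_left t. 0 < s \<and> s < t"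
    using assms(1) eventually_at_left_real[of 0 t] by auto
  then have "\<forall>\<^sub>F s in at_left t. v s \<in> {0<..} - {0}"
    by eventually_elim (use v_pos in auto)
  moreover have "(v \<longlongrightarrow> v t) (at_left t)"
    unfolding v_def using assms(1) by (intro tendsto_intros) auto
  ultimately have vt: "filterlim v (at_right 0) (at_left t)"
    unfolding filterlim_at using assms(2) by (simp add: v_def eventually_conj_iff eventually_neq_at_within)
  note * = interval_integral_FTC_nonneg[of "ereal 0" "ereal t" "\<lambda>s. C * P (v s)" ?g "C * 0" "C * P\<^sub>0"]
  have nn: "0 \<le> ?g s" if "0 < s" "s < t" for s
    using that m(2) passage_density_nonneg assms(2) by auto
  have **: "set_integrable lborel (einterval (ereal 0) (ereal t)) ?g" "(LBINT s=ereal 0..ereal t. ?g s) = C * P\<^sub>0 - C * 0"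
    by (rule *; use assms(1) D cont nn tendsto_mult_left[OF filterlim_compose[OF lim(2) v0], of C]
            tendsto_mult_left[OF filterlim_compose[OF lim(1) vt], of C]
        in \<open>auto simp: ereal_tendsto_simps\<close>)+
  show "set_integrable lborel {0<..<t} ?g" using **(1) by simp
  show "(LBINT s:{0<..<t}. ?g s) = 2 * P\<^sub>0 * sqrt (2 * pi) * heat_kernel t b"
    using **(2) assms(1) by (simp add: interval_integral_Ioo C_def mult.commute mult.left_commute)
qed


text \<open>In probabilistic terms: a path at level \<open>b\<close> at time \<open>t\<close> has first hit \<open>b\<close> at some time \<open>s\<close> and has
then returned to \<open>b\<close> after \<open>t - s\<close>, and the return density is proportional to \<open>(t - s) powr (-1/2)\<close>.\<close>

lemma passage_density_half_integral:
  assumes "t > 0" "b > 0"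
  shows "set_integrable lborel {0<..<t} (\<lambda>s. passage_density s b / (t - s) powr (1/2))" (is ?A)
    and "(LBINT s:{0<..<t}. passage_density s b / (t - s) powr (1/2)) = sqrt (2 * pi) * heat_kernel t b" (is ?B)
proof -
  have "((\<lambda>v. Phi (- v)) \<longlongrightarrow> Phi (- 0)) (at_right 0)"
    by (intro tendsto_intros)
  moreover have "((\<lambda>v. Phi (- v)) \<longlongrightarrow> 0) at_top"
    using filterlim_compose[OF Phi_at_bot filterlim_uminus_at_bot_at_top] .
  moreover have "((\<lambda>v. Phi (- v)) has_real_derivative - (1 * std_normal_density v)) (at v)" for v
    by (auto intro!: derivative_eq_intros simp: std_normal_density_def)
  ultimately show ?A ?B
    using half_integral_substitution[OF assms, of "\<lambda>v. Phi (- v)" "\<lambda>_. 1" "1 / 2"] by (simp_all add: Phi_0)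
qed

lemma passage_density_over_time_half_integral:
  assumes "t > 0" "b > 0"
  shows "set_integrable lborel {0<..<t} (\<lambda>s. passage_density s b / s / (t - s) powr (1/2))" (is ?A)
    and "(LBINT s:{0<..<t}. passage_density s b / s / (t - s) powr (1/2)) =
      sqrt (2 * pi) * heat_kernel t b * (1 / t + 1 / b\<^sup>2)" (is ?B)
proof -
  \<comment> \<open>The second moment of the Gaussian by parts: \<open>Phi (- v) + v * std_normal_density v\<close> has derivative
    \<open>- v\<^sup>2 * std_normal_density v\<close>.\<close>
  define P where "P v = Phi (- v) / t + (Phi (- v) + v * std_normal_density v) / b\<^sup>2" for v
  define m where "m v = 1 / t + v\<^sup>2 / b\<^sup>2" for v
  have "(P \<longlongrightarrow> Phi (- 0) / t + (Phi (- 0) + 0 * (1 / sqrt (2 * pi) * exp (- 0\<^sup>2 / 2))) / b\<^sup>2) (at_right 0)"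
    unfolding P_def std_normal_density_def using assms by (intro tendsto_intros) auto
  then have l0: "(P \<longlongrightarrow> (1 / t + 1 / b\<^sup>2) / 2) (at_right 0)"
    by (simp add: Phi_0 add_divide_distrib mult.commute)
  have "((\<lambda>v. v * std_normal_density v) \<longlongrightarrow> 0) at_top"
    unfolding std_normal_density_def by real_asymp
  note lim = tendsto_add[OF tendsto_divide[OF filterlim_compose[OF Phi_at_bot filterlim_uminus_at_bot_at_top] tendsto_const, of t]
     tendsto_divide[OF tendsto_add[OF filterlim_compose[OF Phi_at_bot filterlim_uminus_at_bot_at_top] this] tendsto_const, of "b\<^sup>2"]]
  have l1: "(P \<longlongrightarrow> 0) at_top"
    using lim assms unfolding P_def by simp
  have D: "(P has_real_derivative - (m v * std_normal_density v)) (at v)" for v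
  proof -
    have sd: "(std_normal_density has_real_derivative - v * std_normal_density v) (at v)"
    proof -
      have "((\<lambda>v. exp (- v\<^sup>2 / 2)) has_real_derivative - v * exp (- v\<^sup>2 / 2)) (at v)"
        by (auto intro!: derivative_eq_intros)
      from DERIV_cmult[OF this, of "1 / sqrt (2 * pi)"] show ?thesis
        unfolding std_normal_density_def by (simp add: mult.left_commute)
    qed
    have "std_normal_density (- v) = std_normal_density v"
      by (simp add: std_normal_density_def)
    then show ?thesis unfolding P_def m_def
      using assms by (auto intro!: derivative_eq_intros sd simp del: std_normal_density_def simp: field_simps power2_eq_square)
  qed
  have "m (b * sqrt (1 / s - 1 / t)) = 1 / s" if "0 < s" "s < t" for s
    using that assms by (simp add: m_def power_mult_distrib field_simps)
  then have eq: "m (b * sqrt (1 / s - 1 / t)) * passage_density s b / (t - s) powr (1/2) =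
      passage_density s b / s / (t - s) powr (1/2)" if "s \<in> {0<..<t}" for s
    using that by simp
  have "continuous_on UNIV m" "\<And>v. 0 \<le> m v"
    using assms by (auto simp: m_def intro!: continuous_intros)
  note * = half_integral_substitution[OF assms D this l0 l1]
  show ?A
    using *(1) by (subst set_integrable_cong[OF refl refl eq[symmetric]]) auto
  show ?B
  proof -
    have "(LBINT s:{0<..<t}. passage_density s b / s / (t - s) powr (1/2)) =
        (LBINT s:{0<..<t}. m (b * sqrt (1 / s - 1 / t)) * passage_density s b / (t - s) powr (1/2))"
      using eq by (intro set_lebesgue_integral_cong) auto
    also have "\<dots> = sqrt (2 * pi) * heat_kernel t b * (1 / t + 1 / b\<^sup>2)"
      unfolding *(2) by simp
    finally show ?thesis .
  qed
qed

text \<open>Tonelli's theorem, applied to the mixture in \<open>passage_density_integral\<close>: the half-order integral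
turns every first-passage density into a heat kernel, and the mixture of heat kernels is
\<open>heat_tail\<close>. The factor \<open>exp (\<gamma>\<^sup>2 / 2 * s)\<close> of the tempered derivative is exactly what cancels the
dependence of the exponential prefactor in \<open>max_density\<close> on time.\<close>

lemma tempered_half_integral:
  assumes "t > 0" "a > 0" "\<gamma> \<ge> 0"
  shows "has_bochner_integral lborel
     (\<lambda>s. indicator {0<..<t} s * (exp (\<gamma>\<^sup>2 / 2 * s) * max_density \<gamma> s a / (t - s) powr (1/2)))
     (2 * sqrt (2 * pi) * exp (\<gamma> * a) * heat_tail \<gamma> t a)"
proof (rule has_bochner_integral_nn_integral)
  let ?I = "\<lambda>s. indicator {0<..<t} s :: ennreal"
  let ?J = "\<lambda>c. indicator {0..} c :: ennreal"
  have eq: "ennreal (indicator {0<..<t} s * (exp (\<gamma>\<^sup>2 / 2 * s) * max_density \<gamma> s a / (t - s) powr (1/2))) =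
     (\<integral>\<^sup>+c. ennreal (2 * exp (\<gamma> * a)) * (?J c * ennreal (exp (- \<gamma> * c)) * (?I s * ennreal (passage_density s (a + c) / (t - s) powr (1/2)))) \<partial>lborel)" for s
  proof (cases "s \<in> {0<..<t}")
    case True
    then have "exp (\<gamma>\<^sup>2 / 2 * s) * max_density \<gamma> s a / (t - s) powr (1/2) =
       2 * exp (\<gamma> * a) / (t - s) powr (1/2) * (heat_kernel s a - \<gamma> * heat_tail \<gamma> s a)"
      by (simp add: max_density_def exp_diff algebra_simps)
    then have "ennreal (indicator {0<..<t} s * (exp (\<gamma>\<^sup>2 / 2 * s) * max_density \<gamma> s a / (t - s) powr (1/2))) =
       ennreal (2 * exp (\<gamma> * a) / (t - s) powr (1/2)) *
       (\<integral>\<^sup>+c. ennreal (exp (- \<gamma> * c) * passage_density s (a + c)) * ?J c \<partial>lborel)"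
      using True assms heat_tail_le_heat_kernel[of s \<gamma> a]
      by (subst passage_density_integral) (auto simp: ennreal_mult[symmetric])
    also have "\<dots> = (\<integral>\<^sup>+c. ennreal (2 * exp (\<gamma> * a) / (t - s) powr (1/2)) * (ennreal (exp (- \<gamma> * c) * passage_density s (a + c)) * ?J c) \<partial>lborel)"
      by (subst nn_integral_cmult) auto
    also have "\<dots> = (\<integral>\<^sup>+c. ennreal (2 * exp (\<gamma> * a)) * (?J c * ennreal (exp (- \<gamma> * c)) * (?I s * ennreal (passage_density s (a + c) / (t - s) powr (1/2)))) \<partial>lborel)"
      using True assms passage_density_nonneg[of s]
      by (intro nn_integral_cong) (auto simp: indicator_def ennreal_mult[symmetric] mult_ac)
    finally show ?thesis .
  qed auto
  have "(\<integral>\<^sup>+s. ennreal (indicator {0<..<t} s * (exp (\<gamma>\<^sup>2 / 2 * s) * max_density \<gamma> s a / (t - s) powr (1/2))) \<partial>lborel) =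
    (\<integral>\<^sup>+c. (\<integral>\<^sup>+s. ennreal (2 * exp (\<gamma> * a)) * (?J c * ennreal (exp (- \<gamma> * c)) * (?I s * ennreal (passage_density s (a + c) / (t - s) powr (1/2)))) \<partial>lborel) \<partial>lborel)"
    unfolding eq by (rule lborel_pair.Fubini') measurable
  also have "\<dots> = (\<integral>\<^sup>+c. ennreal (2 * exp (\<gamma> * a)) * (?J c * ennreal (exp (- \<gamma> * c)) *
       (\<integral>\<^sup>+s. ?I s * ennreal (passage_density s (a + c) / (t - s) powr (1/2)) \<partial>lborel)) \<partial>lborel)"
    by (intro nn_integral_cong) (simp add: nn_integral_cmult)
  also have "\<dots> = (\<integral>\<^sup>+c. ennreal (2 * exp (\<gamma> * a) * sqrt (2 * pi)) * (ennreal (exp (- \<gamma> * c) * heat_kernel t (a + c)) * ?J c) \<partial>lborel)"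
  proof (intro nn_integral_cong)
    fix c :: real
    have "(\<integral>\<^sup>+s. ?I s * ennreal (passage_density s (a + c) / (t - s) powr (1/2)) \<partial>lborel) =
       ennreal (sqrt (2 * pi) * heat_kernel t (a + c))" if "c \<ge> 0"
    proof -
      have "(\<integral>\<^sup>+s. ?I s * ennreal (passage_density s (a + c) / (t - s) powr (1/2)) \<partial>lborel) =
        (\<integral>\<^sup>+s. ennreal (indicator {0<..<t} s *\<^sub>R (passage_density s (a + c) / (t - s) powr (1/2))) \<partial>lborel)"
        by (intro nn_integral_cong) (auto simp: indicator_def)
      also have "\<dots> = ennreal (LBINT s:{0<..<t}. passage_density s (a + c) / (t - s) powr (1/2))"
        unfolding set_lebesgue_integral_def
        using passage_density_half_integral(1)[of t "a + c"] that assms passage_density_nonneg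
        by (intro nn_integral_eq_integral) (auto simp: set_integrable_def indicator_def)
      finally show ?thesis
        using passage_density_half_integral(2)[of t "a + c"] that assms by simp
    qed
    then show "ennreal (2 * exp (\<gamma> * a)) * (?J c * ennreal (exp (- \<gamma> * c)) *
       (\<integral>\<^sup>+s. ?I s * ennreal (passage_density s (a + c) / (t - s) powr (1/2)) \<partial>lborel)) =
       ennreal (2 * exp (\<gamma> * a) * sqrt (2 * pi)) * (ennreal (exp (- \<gamma> * c) * heat_kernel t (a + c)) * ?J c)"
      using heat_kernel_pos[OF assms(1), THEN less_imp_le] by (auto simp: indicator_def ennreal_mult[symmetric] mult_ac)
  qed
  also have "\<dots> = ennreal (2 * exp (\<gamma> * a) * sqrt (2 * pi)) * ennreal (heat_tail \<gamma> t a)"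
    using assms by (subst nn_integral_cmult) (auto simp: heat_tail_eq_integral[simplified])
  also have "\<dots> = ennreal (2 * sqrt (2 * pi) * exp (\<gamma> * a) * heat_tail \<gamma> t a)"
    using heat_tail_nonneg by (simp add: ennreal_mult[symmetric] mult_ac)
  finally show "(\<integral>\<^sup>+s. ennreal (indicator {0<..<t} s * (exp (\<gamma>\<^sup>2 / 2 * s) * max_density \<gamma> s a / (t - s) powr (1/2))) \<partial>lborel) =
    ennreal (2 * sqrt (2 * pi) * exp (\<gamma> * a) * heat_tail \<gamma> t a)" .
  show "AE s in lborel. 0 \<le> indicator {0<..<t} s * (exp (\<gamma>\<^sup>2 / 2 * s) * max_density \<gamma> s a / (t - s) powr (1/2))"
    using assms max_density_nonneg by (auto simp: indicator_def)
qed (use heat_tail_nonneg in auto)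


section \<open>The fractional derivatives of the density\<close>

lemma tempered_RL_integral_max_density:
  assumes "t > 0" "x > 0" "\<delta> > 0" "\<gamma> \<ge> 0"
    and g: "\<And>s. s > 0 \<Longrightarrow> g s = \<delta> * max_density \<gamma> s (\<delta> * x)"
  shows "set_integrable lborel {0<..<t} (\<lambda>s. exp (\<gamma>\<^sup>2 / 2 * s) * g s / (t - s) powr (1/2))" (is ?A)
    and "tempered_RL_integral (1/2) (\<gamma>\<^sup>2 / 2) g t = \<delta> * (2 * sqrt (2 * pi) * exp (\<gamma> * (\<delta> * x)) * heat_tail \<gamma> t (\<delta> * x))" (is ?B)
proof -
  have "has_bochner_integral lborel
     (\<lambda>s. \<delta> * (indicator {0<..<t} s * (exp (\<gamma>\<^sup>2 / 2 * s) * max_density \<gamma> s (\<delta> * x) / (t - s) powr (1/2))))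
     (\<delta> * (2 * sqrt (2 * pi) * exp (\<gamma> * (\<delta> * x)) * heat_tail \<gamma> t (\<delta> * x)))"
    using assms by (intro has_bochner_integral_mult_right tempered_half_integral) auto
  moreover have "(\<lambda>s. \<delta> * (indicator {0<..<t} s * (exp (\<gamma>\<^sup>2 / 2 * s) * max_density \<gamma> s (\<delta> * x) / (t - s) powr (1/2)))) =
      (\<lambda>s. indicator {0<..<t} s *\<^sub>R (exp (\<gamma>\<^sup>2 / 2 * s) * g s / (t - s) powr (1/2)))"
    by (auto simp: fun_eq_iff indicator_def g)
  ultimately show ?A ?B
    by (simp_all add: has_bochner_integral_iff set_integrable_def set_lebesgue_integral_def tempered_RL_integral_def)
qed

lemma tempered_RL_deriv_max_density:
  assumes "t > 0" "x > 0" "\<delta> > 0" "\<gamma> \<ge> 0"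
    and g: "\<And>s. s > 0 \<Longrightarrow> g s = \<delta> * max_density \<gamma> s (\<delta> * x)"
  shows "tempered_RL_differentiable (1/2) (\<gamma>\<^sup>2 / 2) g t" (is ?A)
    and "sqrt 2 * \<delta> * tempered_RL_deriv (1/2) (\<gamma>\<^sup>2 / 2) g t =
      - (\<delta>\<^sup>2 * (exp (\<gamma> * (\<delta> * x) - \<gamma>\<^sup>2 * t / 2) *
          (4 * \<gamma> * heat_kernel t (\<delta> * x) - 4 * \<gamma>\<^sup>2 * heat_tail \<gamma> t (\<delta> * x) - 2 * (\<delta> * x / t) * heat_kernel t (\<delta> * x))))" (is ?B)
proof -
  let ?a = "\<delta> * x" let ?lam = "\<gamma>\<^sup>2 / 2"
  let ?I = "tempered_RL_integral (1/2) ?lam g"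
  let ?K = "heat_kernel t ?a" and ?W = "heat_tail \<gamma> t ?a"
  have ev: "\<forall>\<^sub>F \<tau> in nhds t. 0 < \<tau>"
    using eventually_nhds_in_open[of "{0<..}" t] assms(1) by simp
  have "((\<lambda>\<tau>. \<delta> * (2 * sqrt (2 * pi) * exp (\<gamma> * ?a) * heat_tail \<gamma> \<tau> ?a)) has_real_derivative
     \<delta> * (2 * sqrt (2 * pi) * exp (\<gamma> * ?a) * (\<gamma>\<^sup>2 / 2 * ?W + (?a / t - \<gamma>) / 2 * ?K))) (at t)"
    by (intro DERIV_cmult heat_tail_deriv_time assms)
  moreover have "\<forall>\<^sub>F \<tau> in nhds t. ?I \<tau> = \<delta> * (2 * sqrt (2 * pi) * exp (\<gamma> * ?a) * heat_tail \<gamma> \<tau> ?a)"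
    using ev by eventually_elim (rule tempered_RL_integral_max_density(2)[OF _ assms(2-5)])
  ultimately have D: "(?I has_real_derivative
     \<delta> * (2 * sqrt (2 * pi) * exp (\<gamma> * ?a) * (\<gamma>\<^sup>2 / 2 * ?W + (?a / t - \<gamma>) / 2 * ?K))) (at t)"
    by (subst DERIV_cong_ev[OF refl _ refl])
  have "\<forall>\<^sub>F \<tau> in nhds t. set_integrable lborel {0<..<\<tau>} (\<lambda>s. exp (?lam * s) * g s / (\<tau> - s) powr (1/2))"
    using ev by eventually_elim (rule tempered_RL_integral_max_density(1)[OF _ assms(2-5)])
  moreover have "?I differentiable at t"
    using D unfolding real_differentiable_def by blast
  ultimately show ?A
    unfolding tempered_RL_differentiable_def by simp
  have s: "sqrt 2 * ?lam powr (1/2) = \<gamma>"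
    using assms(4) by (simp add: powr_half_sqrt real_sqrt_divide)
  have G: "Gamma (1 - 1/2) = sqrt (pi::real)"
    using Gamma_one_half_real by simp
  have gt: "g t = \<delta> * (exp (\<gamma> * ?a) * exp (- ?lam * t)) * (2 * ?K - 2 * \<gamma> * ?W)"
    using g[OF assms(1)] by (simp add: max_density_def exp_add[symmetric] algebra_simps)
  \<comment> \<open>Read \<open>r\<close> as \<open>sqrt 2\<close>, \<open>p\<close> as \<open>sqrt pi\<close>, \<open>L\<close> as \<open>\<lambda> powr (1/2)\<close>, \<open>X\<close> as the time derivative of
    \<open>heat_tail\<close> and \<open>Y\<close> as the bracket in \<open>max_density\<close>.\<close>
  have alg: "r * \<delta> * (e2 * (1 / p) * (\<delta> * (2 * (r * p) * e1 * X)) - L * (\<delta> * (e1 * e2) * Y)) =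
      \<delta>\<^sup>2 * (e1 * e2) * ((r * r) * 2 * X - (r * L) * Y)" if "p > 0" for r e1 e2 p L X Y :: real
    using that by (simp add: field_simps power2_eq_square)
  have "sqrt 2 * \<delta> * tempered_RL_deriv (1/2) ?lam g t =
     \<delta>\<^sup>2 * (exp (\<gamma> * ?a) * exp (- ?lam * t)) *
       ((sqrt 2 * sqrt 2) * 2 * (\<gamma>\<^sup>2 / 2 * ?W + (?a / t - \<gamma>) / 2 * ?K) - (sqrt 2 * ?lam powr (1/2)) * (2 * ?K - 2 * \<gamma> * ?W))"
    unfolding tempered_RL_deriv_def DERIV_imp_deriv[OF D] G gt real_sqrt_mult[of 2 pi]
    by (rule alg) simp
  also have "exp (\<gamma> * ?a) * exp (- ?lam * t) = exp (\<gamma> * ?a - \<gamma>\<^sup>2 * t / 2)"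
    by (simp add: exp_add[symmetric])
  finally have "sqrt 2 * \<delta> * tempered_RL_deriv (1/2) ?lam g t =
     \<delta>\<^sup>2 * exp (\<gamma> * ?a - \<gamma>\<^sup>2 * t / 2) *
       ((sqrt 2 * sqrt 2) * 2 * (\<gamma>\<^sup>2 / 2 * ?W + (?a / t - \<gamma>) / 2 * ?K) - \<gamma> * (2 * ?K - 2 * \<gamma> * ?W))"
    unfolding s .
  moreover have "\<delta>\<^sup>2 * E * ((sqrt 2 * sqrt 2) * 2 * (\<gamma>\<^sup>2 / 2 * w + (q - \<gamma>) / 2 * k) - \<gamma> * (2 * k - 2 * \<gamma> * w)) =
      - (\<delta>\<^sup>2 * (E * (4 * \<gamma> * k - 4 * \<gamma>\<^sup>2 * w - 2 * q * k)))" for E w q k :: real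
    by (simp add: field_simps power2_eq_square)
  ultimately show ?B by (simp only:)
qed

text \<open>The time derivative of \<open>2 * heat_kernel r x\<close> is \<open>x\<close> times \<open>passage_density r x / r\<close> minus \<open>1 / x\<close>
times \<open>passage_density r x\<close>. Each of the two has a half-order integral in closed form, and the
terms with \<open>1 / x\<close> cancel.\<close>

lemma caputo_deriv_heat_kernel:
  assumes "t > 0" "x > 0" "g 0 = 0"
    and g: "\<And>s. s > 0 \<Longrightarrow> g s = 2 * heat_kernel s x"
  shows "caputo_differentiable (1/2) g t" (is ?A)
    and "caputo_deriv (1/2) g t = sqrt 2 * (x / t) * heat_kernel t x" (is ?B)
proof -
  let ?D = "\<lambda>r. (x\<^sup>2 / r\<^sup>2 - 1 / r) * heat_kernel r x"
  have D: "(g has_real_derivative ?D r) (at r)" if "r > 0" for r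
  proof -
    have "\<forall>\<^sub>F s in nhds r. g s = 2 * heat_kernel s x"
      using eventually_nhds_in_open[of "{0<..}" r] that by (auto elim!: eventually_mono intro: g)
    moreover have "((\<lambda>s. 2 * heat_kernel s x) has_real_derivative ?D r) (at r)"
      by (rule DERIV_cong[OF DERIV_cmult[OF heat_kernel_deriv_time[OF that]]]) simp
    ultimately show ?thesis
      by (subst DERIV_cong_ev[OF refl _ refl])
  qed
  have "((\<lambda>s. 2 * heat_kernel s x) \<longlongrightarrow> 0) (at_right 0)"
    unfolding heat_kernel_def using assms(2) by real_asymp
  then have "(g \<longlongrightarrow> g 0) (at_right 0)"
    unfolding assms(3)
    by (rule Lim_transform_eventually) (auto simp: g intro: eventually_mono[OF eventually_at_right_less])
  moreover have "at 0 within {0..t} \<le> at_right 0"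
    using assms(1) by (simp add: at_within_Icc_at_right)
  ultimately have "continuous (at 0 within {0..t}) g"
    unfolding continuous_within by (rule tendsto_mono[rotated])
  moreover have "continuous (at r within {0..t}) g" if "r > 0" for r
    using DERIV_isCont[OF D[OF that]] continuous_at_imp_continuous_at_within by blast
  ultimately have cont: "continuous_on {0..t} g"
    unfolding continuous_on_eq_continuous_within by (metis atLeastAtMost_iff order_le_less)
  let ?p = "\<lambda>r. passage_density r x / r / (t - r) powr (1/2)" and ?q = "\<lambda>r. passage_density r x / (t - r) powr (1/2)"
  have eq: "deriv g r / (t - r) powr (1/2) = x * ?p r - 1 / x * ?q r" if "r \<in> {0<..<t}" for r
  proof -
    have "?D r = x * (passage_density r x / r) - 1 / x * passage_density r x"
      using that assms(2) by (simp add: passage_density_def field_simps power2_eq_square)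
    then show ?thesis
      using that DERIV_imp_deriv[OF D, of r] by (simp add: diff_divide_distrib)
  qed
  have int: "set_integrable lborel {0<..<t} (\<lambda>r. x * ?p r)" "set_integrable lborel {0<..<t} (\<lambda>r. 1 / x * ?q r)"
    by (intro set_integrable_mult_right passage_density_over_time_half_integral passage_density_half_integral assms)+
  have "set_integrable lborel {0<..<t} (\<lambda>r. deriv g r / (t - r) powr (1/2))"
    by (subst set_integrable_cong[OF refl refl eq]) (use set_integral_diff(1)[OF int] in auto)
  then show ?A
    unfolding caputo_differentiable_def real_differentiable_def using cont D by (meson greaterThanLessThan_iff)
  have "(LBINT r:{0<..<t}. deriv g r / (t - r) powr (1/2)) = (LBINT r:{0<..<t}. x * ?p r - 1 / x * ?q r)"
    by (rule set_lebesgue_integral_cong) (auto simp: eq)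
  also have "\<dots> = x * (LBINT r:{0<..<t}. ?p r) - 1 / x * (LBINT r:{0<..<t}. ?q r)"
    unfolding set_integral_diff(2)[OF int] by (simp only: set_integral_mult_right)
  also have "\<dots> = sqrt (2 * pi) * (x / t) * heat_kernel t x"
    unfolding passage_density_over_time_half_integral(2)[OF assms(1,2)] passage_density_half_integral(2)[OF assms(1,2)]
    using assms(1,2) by (simp add: field_simps power2_eq_square)
  finally show ?B
    using Gamma_one_half_real by (simp add: caputo_deriv_def real_sqrt_mult)
qed


section \<open>The law of the maximum as a space-time harmonic function\<close>

lemma max_cdf_0: "max_cdf \<gamma> t 0 = 0"
  by (simp add: max_cdf_def)

lemma max_cdf_bound:
  assumes "t > 0" "\<gamma> \<ge> 0"
  shows "\<bar>max_cdf \<gamma> t a\<bar> \<le> 1"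
proof -
  have "max_cdf \<gamma> t a \<le> 1"
    using Phi_le_1[of "(a - \<gamma> * t) / sqrt t"] Phi_nonneg[of "- (a + \<gamma> * t) / sqrt t"]
    by (simp add: max_cdf_def) (smt (verit) exp_gt_zero mult_nonneg_nonneg)
  moreover have "- 1 \<le> max_cdf \<gamma> t a"
  proof (cases "a \<ge> 0")
    case True
    have "max_cdf \<gamma> t 0 \<le> max_cdf \<gamma> t a"
      by (rule DERIV_nonneg_imp_nondecreasing[OF True])
         (use max_cdf_deriv[OF assms(1)] max_density_nonneg[OF assms] in blast)
    then show ?thesis by (simp add: max_cdf_0)
  next
    case False
    then have "exp (2 * \<gamma> * a) \<le> 1"
      using assms(2) by (simp add: mult_nonneg_nonpos)
    then have "exp (2 * \<gamma> * a) * Phi (- (a + \<gamma> * t) / sqrt t) \<le> 1 * 1"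
      by (intro mult_mono Phi_le_1 Phi_nonneg) auto
    then show ?thesis
      using Phi_nonneg[of "(a - \<gamma> * t) / sqrt t"] by (simp add: max_cdf_def)
  qed
  ultimately show ?thesis by linarith
qed

text \<open>A bound by a multiple of the overshoot \<open>y\<close>, uniform over all times \<open>t \<ge> \<epsilon>\<close>. It comes from \<open>max_cdf\<close>
vanishing at 0 and having a bounded derivative to the left of 0. No such bound holds uniformly down
to \<open>t = 0\<close>, where \<open>max_cdf\<close> jumps at \<open>a = 0\<close>.\<close>

lemma max_cdf_overshoot:
  assumes "0 < \<epsilon>" "\<epsilon> \<le> t" "\<gamma> \<ge> 0" "y \<ge> 0"
  shows "\<bar>max_cdf \<gamma> t (- y)\<bar> \<le> (2 / sqrt (2 * pi * \<epsilon>) + 2 * \<gamma>) * y"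
proof -
  have t: "t > 0" using assms by simp
  have dens: "\<bar>max_density \<gamma> t a\<bar> \<le> 2 / sqrt (2 * pi * \<epsilon>) + 2 * \<gamma>" if "a \<le> 0" for a
  proof -
    have a: "\<gamma> * a \<le> 0" using that assms(3) by (simp add: mult_nonneg_nonpos)
    have "exp (\<gamma> * a - \<gamma>\<^sup>2 * t / 2) \<le> 1"
      using a t by (simp add: order_trans[of _ 0])
    moreover have "heat_kernel t a \<le> 1 / sqrt (2 * pi * \<epsilon>)"
      unfolding heat_kernel_def using t assms(1,2) by (intro frac_le) auto
    ultimately have "exp (\<gamma> * a - \<gamma>\<^sup>2 * t / 2) * heat_kernel t a \<le> 1 * (1 / sqrt (2 * pi * \<epsilon>))"
      using heat_kernel_pos[OF t, of a] by (intro mult_mono) auto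
    moreover have "exp (\<gamma> * a - \<gamma>\<^sup>2 * t / 2) * heat_tail \<gamma> t a = exp (2 * (\<gamma> * a)) * Phi (- (a + \<gamma> * t) / sqrt t)"
      by (simp add: heat_tail_def mult.assoc[symmetric] exp_add[symmetric])
    moreover have "exp (2 * (\<gamma> * a)) * Phi (- (a + \<gamma> * t) / sqrt t) \<le> 1 * 1"
      using a by (intro mult_mono Phi_le_1 Phi_nonneg) auto
    ultimately have 1: "exp (\<gamma> * a - \<gamma>\<^sup>2 * t / 2) * heat_kernel t a \<le> 1 / sqrt (2 * pi * \<epsilon>)"
      and 2: "exp (\<gamma> * a - \<gamma>\<^sup>2 * t / 2) * heat_tail \<gamma> t a \<le> 1"
      by simp_all
    have "0 \<le> exp (\<gamma> * a - \<gamma>\<^sup>2 * t / 2) * heat_kernel t a" "0 \<le> \<gamma> * (exp (\<gamma> * a - \<gamma>\<^sup>2 * t / 2) * heat_tail \<gamma> t a)"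
      using heat_kernel_pos[OF t, of a] heat_tail_nonneg assms(3) by simp_all
    moreover have "\<gamma> * (exp (\<gamma> * a - \<gamma>\<^sup>2 * t / 2) * heat_tail \<gamma> t a) \<le> \<gamma>"
      using mult_left_mono[OF 2 assms(3)] by simp
    moreover have "max_density \<gamma> t a = 2 * (exp (\<gamma> * a - \<gamma>\<^sup>2 * t / 2) * heat_kernel t a) -
        2 * (\<gamma> * (exp (\<gamma> * a - \<gamma>\<^sup>2 * t / 2) * heat_tail \<gamma> t a))"
      by (simp add: max_density_def algebra_simps)
    ultimately show ?thesis using 1 by (simp add: abs_le_iff)
  qed
  have "norm (max_cdf \<gamma> t (- y) - max_cdf \<gamma> t 0) \<le> (2 / sqrt (2 * pi * \<epsilon>) + 2 * \<gamma>) * norm (- y - 0)"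
    by (rule field_differentiable_bound[where S="{- y..0}" and f'="max_density \<gamma> t"])
       (use assms(4) dens max_cdf_deriv[OF t] in \<open>auto intro: has_field_derivative_at_within\<close>)
  then show ?thesis using assms(4) by (simp add: max_cdf_0)
qed

lemma max_cdf_at_time_0:
  assumes "a > 0"
  shows "((\<lambda>t. max_cdf \<gamma> t a) \<longlongrightarrow> 1) (at_right 0)"
proof -
  have 1: "filterlim (\<lambda>t. (a - \<gamma> * t) / sqrt t) at_top (at_right 0)"
    using assms by real_asymp
  have 2: "filterlim (\<lambda>t. - (a + \<gamma> * t) / sqrt t) at_bot (at_right 0)"
    using assms by real_asymp
  show ?thesis
    unfolding max_cdf_def
    using tendsto_diff[OF filterlim_compose[OF Phi_at_top 1] tendsto_mult_right_zero[OF filterlim_compose[OF Phi_at_bot 2], of "exp (2 * \<gamma> * a)"]]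
    by simp
qed

lemma max_cdf_cont_time:
  assumes "t > 0"
  shows "isCont (\<lambda>t. max_cdf \<gamma> t a) t"
  unfolding max_cdf_def isCont_def using assms by (intro tendsto_intros) auto

lemma Phi_normal_cdf:
  assumes "s > 0"
  shows "(\<integral>\<^sup>+w. ennreal (normal_density 0 (sqrt s) w) * indicator {..c} w \<partial>lborel) = ennreal (Phi (c / sqrt s))"
proof -
  have nd: "normal_density 0 (sqrt s) (0 + sqrt s * u) = std_normal_density u / sqrt s" for u
    using assms by (simp add: normal_density_def power_mult_distrib real_sqrt_mult)
  have "(\<integral>\<^sup>+w. ennreal (normal_density 0 (sqrt s) w) * indicator {..c} w \<partial>lborel) =
     ennreal \<bar>sqrt s\<bar> * (\<integral>\<^sup>+u. ennreal (normal_density 0 (sqrt s) (0 + sqrt s * u)) * indicator {..c} (0 + sqrt s * u) \<partial>lborel)"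
    using assms by (intro nn_integral_real_affine) auto
  also have "\<dots> = (\<integral>\<^sup>+u. ennreal \<bar>sqrt s\<bar> * (ennreal (normal_density 0 (sqrt s) (0 + sqrt s * u)) * indicator {..c} (0 + sqrt s * u)) \<partial>lborel)"
    by (intro nn_integral_cmult[symmetric]) auto
  also have "\<dots> = (\<integral>\<^sup>+u. ennreal (indicator {..c / sqrt s} u *\<^sub>R std_normal_density u) \<partial>lborel)"
    unfolding nd using assms
    by (intro nn_integral_cong) (auto simp: indicator_def ennreal_mult[symmetric] field_simps)
  also have "\<dots> = ennreal (Phi (c / sqrt s))"
    unfolding Phi_eq_integral set_lebesgue_integral_def
    using set_integrable_std_normal_density[of "{..c / sqrt s}"]
    by (intro nn_integral_eq_integral) (auto simp: set_integrable_def)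
  finally show ?thesis .
qed

text \<open>The sum of independent centred normal variables of variances \<open>s\<close> and \<open>d\<close> has variance \<open>s + d\<close>.\<close>

lemma Phi_semigroup:
  assumes "s > 0" "d > 0"
  shows "has_bochner_integral lborel (\<lambda>z. normal_density 0 (sqrt d) z * Phi ((c - z) / sqrt s)) (Phi (c / sqrt (s + d)))"
proof (rule has_bochner_integral_nn_integral)
  let ?n = "\<lambda>s x. ennreal (normal_density 0 (sqrt s) x)"
  have "(\<integral>\<^sup>+z. ennreal (normal_density 0 (sqrt d) z * Phi ((c - z) / sqrt s)) \<partial>lborel) =
      (\<integral>\<^sup>+z. (\<integral>\<^sup>+u. ?n s (u - z) * ?n d z * indicator {..c} u \<partial>lborel) \<partial>lborel)"
  proof (intro nn_integral_cong)
    fix z :: real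
    have "ennreal (normal_density 0 (sqrt d) z * Phi ((c - z) / sqrt s)) =
       ?n d z * (\<integral>\<^sup>+w. ?n s w * indicator {..c - z} w \<partial>lborel)"
      by (simp add: Phi_normal_cdf[OF assms(1)] ennreal_mult Phi_nonneg)
    also have "(\<integral>\<^sup>+w. ?n s w * indicator {..c - z} w \<partial>lborel) =
       (\<integral>\<^sup>+u. ?n s (- z + 1 * u) * indicator {..c - z} (- z + 1 * u) \<partial>lborel)"
      by (subst nn_integral_real_affine[where c=1 and t="- z"]) auto
    also have "\<dots> = (\<integral>\<^sup>+u. ?n s (u - z) * indicator {..c} u \<partial>lborel)"
      by (intro nn_integral_cong) (auto simp: indicator_def)
    also have "?n d z * \<dots> = (\<integral>\<^sup>+u. ?n s (u - z) * ?n d z * indicator {..c} u \<partial>lborel)"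
      by (subst nn_integral_cmult[symmetric]) (auto simp: mult_ac)
    finally show "ennreal (normal_density 0 (sqrt d) z * Phi ((c - z) / sqrt s)) =
       (\<integral>\<^sup>+u. ?n s (u - z) * ?n d z * indicator {..c} u \<partial>lborel)" .
  qed
  also have "\<dots> = (\<integral>\<^sup>+u. (\<integral>\<^sup>+z. ?n s (u - z) * ?n d z * indicator {..c} u \<partial>lborel) \<partial>lborel)"
    by (rule lborel_pair.Fubini') measurable
  also have "\<dots> = (\<integral>\<^sup>+u. ?n (s + d) u * indicator {..c} u \<partial>lborel)"
  proof (intro nn_integral_cong)
    fix u :: real
    have "(\<integral>\<^sup>+z. ?n s (u - z) * ?n d z \<partial>lborel) = ?n (s + d) u"
      using fun_cong[OF conv_normal_density_zero_mean[of "sqrt s" "sqrt d"], of u] assms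
      by (simp add: ennreal_mult)
    then show "(\<integral>\<^sup>+z. ?n s (u - z) * ?n d z * indicator {..c} u \<partial>lborel) = ?n (s + d) u * indicator {..c} u"
      by (subst nn_integral_multc) auto
  qed
  also have "\<dots> = ennreal (Phi (c / sqrt (s + d)))"
    using assms by (intro Phi_normal_cdf) auto
  finally show "(\<integral>\<^sup>+z. ennreal (normal_density 0 (sqrt d) z * Phi ((c - z) / sqrt s)) \<partial>lborel) = ennreal (Phi (c / sqrt (s + d)))" .
qed (auto simp: Phi_nonneg)

text \<open>Averaging over one step of length \<open>d\<close> of the Brownian motion with drift. For the first summand of
\<open>max_cdf\<close> this is \<open>Phi_semigroup\<close>. For the second, the exponential weight moves the centre of the
Gaussian step by \<open>- 2 \<gamma> d\<close>, which turns the drift \<open>\<gamma>\<close> into \<open>- \<gamma>\<close> and reduces it to the first case.\<close>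

lemma max_cdf_semigroup:
  assumes "s > 0" "d > 0"
  shows "(\<integral>z. normal_density 0 (sqrt d) z * max_cdf \<gamma> s (a - \<gamma> * d - z) \<partial>lborel) = max_cdf \<gamma> (s + d) a"
proof -
  have 1: "has_bochner_integral lborel (\<lambda>z. normal_density 0 (sqrt d) z * Phi ((a - \<gamma> * (s + d) - z) / sqrt s))
      (Phi ((a - \<gamma> * (s + d)) / sqrt (s + d)))"
    by (rule Phi_semigroup[OF assms])
  have "has_bochner_integral lborel (\<lambda>z. exp (2 * \<gamma> * a) * (normal_density 0 (sqrt d) z * Phi ((- (a + \<gamma> * (s + d)) - z) / sqrt s)))
      (exp (2 * \<gamma> * a) * Phi (- (a + \<gamma> * (s + d)) / sqrt (s + d)))"
    by (intro has_bochner_integral_mult_right Phi_semigroup assms)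
  \<comment> \<open>The substitution \<open>z \<mapsto> - 2 \<gamma> d - z\<close> undoes the exponential weight.\<close>
  also have "(\<lambda>z. exp (2 * \<gamma> * a) * (normal_density 0 (sqrt d) z * Phi ((- (a + \<gamma> * (s + d)) - z) / sqrt s))) =
    (\<lambda>z. normal_density 0 (sqrt d) (- 2 * \<gamma> * d + - 1 * z) * (exp (2 * \<gamma> * (a - \<gamma> * d - (- 2 * \<gamma> * d + - 1 * z))) *
        Phi (- (a - \<gamma> * d - (- 2 * \<gamma> * d + - 1 * z) + \<gamma> * s) / sqrt s)))"
  proof
    fix z
    have "2 * \<gamma> * a + - z\<^sup>2 / (2 * d) = - (- 2 * \<gamma> * d + - 1 * z)\<^sup>2 / (2 * d) + 2 * \<gamma> * (a - \<gamma> * d - (- 2 * \<gamma> * d + - 1 * z))"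
      using assms by (simp add: field_simps power2_eq_square)
    then have "exp (2 * \<gamma> * a) * exp (- z\<^sup>2 / (2 * d)) =
      exp (- (- 2 * \<gamma> * d + - 1 * z)\<^sup>2 / (2 * d)) * exp (2 * \<gamma> * (a - \<gamma> * d - (- 2 * \<gamma> * d + - 1 * z)))"
      unfolding exp_add[symmetric] by (rule arg_cong)
    then have "exp (2 * \<gamma> * a) * normal_density 0 (sqrt d) z =
      normal_density 0 (sqrt d) (- 2 * \<gamma> * d + - 1 * z) * exp (2 * \<gamma> * (a - \<gamma> * d - (- 2 * \<gamma> * d + - 1 * z)))"
      using assms by (simp add: normal_density_def)
    moreover have "- (a + \<gamma> * (s + d)) - z = - (a - \<gamma> * d - (- 2 * \<gamma> * d + - 1 * z) + \<gamma> * s)"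
      by (simp add: algebra_simps)
    ultimately show "exp (2 * \<gamma> * a) * (normal_density 0 (sqrt d) z * Phi ((- (a + \<gamma> * (s + d)) - z) / sqrt s)) =
      normal_density 0 (sqrt d) (- 2 * \<gamma> * d + - 1 * z) * (exp (2 * \<gamma> * (a - \<gamma> * d - (- 2 * \<gamma> * d + - 1 * z))) *
        Phi (- (a - \<gamma> * d - (- 2 * \<gamma> * d + - 1 * z) + \<gamma> * s) / sqrt s))"
      by (simp only: mult.assoc[symmetric])
  qed
  finally have 2: "has_bochner_integral lborel (\<lambda>z. normal_density 0 (sqrt d) z * (exp (2 * \<gamma> * (a - \<gamma> * d - z)) *
        Phi (- (a - \<gamma> * d - z + \<gamma> * s) / sqrt s)))
      (exp (2 * \<gamma> * a) * Phi (- (a + \<gamma> * (s + d)) / sqrt (s + d)))"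
    by (subst lborel_has_bochner_integral_real_affine_iff[where c="- 1" and t="- 2 * \<gamma> * d"]) simp_all
  have eq: "normal_density 0 (sqrt d) z * Phi ((a - \<gamma> * (s + d) - z) / sqrt s) -
        normal_density 0 (sqrt d) z * (exp (2 * \<gamma> * (a - \<gamma> * d - z)) * Phi (- (a - \<gamma> * d - z + \<gamma> * s) / sqrt s)) =
      normal_density 0 (sqrt d) z * max_cdf \<gamma> s (a - \<gamma> * d - z)" for z
    by (simp add: max_cdf_def algebra_simps)
  show ?thesis
    using has_bochner_integral_diff[OF 1 2] unfolding eq by (simp add: has_bochner_integral_iff max_cdf_def)
qed

text \<open>The martingale property over one step, without conditional expectations: \<open>U\<close> carries the past, \<open>N\<close>
is a bounded weight depending on it, \<open>L\<close> the distance to the barrier, and \<open>p (V \<omega>)\<close> the next increment. The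
increment is a function of \<open>V\<close> because \<open>indep_var\<close> compares variables of one common type, and the
past is a family of reals.\<close>

lemma (in prob_space) max_cdf_conditional_step:
  assumes indep: "indep_var S U T V"
    and V: "distributed M lborel (\<lambda>\<omega>. p (V \<omega>)) (normal_density 0 (sqrt d))"
    and [measurable]: "N \<in> borel_measurable S" "L \<in> borel_measurable S" "p \<in> borel_measurable T"
    and N: "\<And>u. \<bar>N u\<bar> \<le> (1::real)"
    and "s > 0" "d > 0" "\<gamma> \<ge> 0"
  shows "expectation (\<lambda>\<omega>. N (U \<omega>) * max_cdf \<gamma> s (L (U \<omega>) - \<gamma> * d - p (V \<omega>))) =
    expectation (\<lambda>\<omega>. N (U \<omega>) * max_cdf \<gamma> (s + d) (L (U \<omega>)))"
proof -
  have [measurable]: "U \<in> measurable M S" "V \<in> measurable M T"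
    using indep indep_var_rv1 indep_var_rv2 by blast+
  let ?g = "\<lambda>(u, v). N u * max_cdf \<gamma> s (L u - \<gamma> * d - p v)"
  have bound: "\<bar>N u * max_cdf \<gamma> s y\<bar> \<le> 1" for u y
    using mult_mono[OF N max_cdf_bound[OF assms(7,9)]] by (simp add: abs_mult)
  interpret U: prob_space "distr M S U" by (rule prob_space_distr) measurable
  interpret V: prob_space "distr M T V" by (rule prob_space_distr) measurable
  interpret UV: pair_prob_space "distr M S U" "distr M T V" ..
  have [measurable]: "?g \<in> borel_measurable (S \<Otimes>\<^sub>M T)"
    by measurable
  have int: "integrable (distr M S U \<Otimes>\<^sub>M distr M T V) ?g"
    by (rule UV.integrable_const_bound[where B=1]) (auto simp: bound)
  have "expectation (\<lambda>\<omega>. ?g (U \<omega>, V \<omega>)) = (\<integral>q. ?g q \<partial>distr M (S \<Otimes>\<^sub>M T) (\<lambda>\<omega>. (U \<omega>, V \<omega>)))"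
    by (subst integral_distr) auto
  also have "\<dots> = (\<integral>q. ?g q \<partial>(distr M S U \<Otimes>\<^sub>M distr M T V))"
    using indep by (simp add: indep_var_distribution_eq)
  also have "\<dots> = (\<integral>u. (\<integral>v. ?g (u, v) \<partial>distr M T V) \<partial>distr M S U)"
    by (rule UV.integral_fst'[OF int, symmetric])
  also have "\<dots> = expectation (\<lambda>\<omega>. \<integral>v. ?g (U \<omega>, v) \<partial>distr M T V)"
    by (subst integral_distr) (auto intro!: V.borel_measurable_lebesgue_integral)
  finally have 1: "expectation (\<lambda>\<omega>. ?g (U \<omega>, V \<omega>)) = expectation (\<lambda>\<omega>. \<integral>v. ?g (U \<omega>, v) \<partial>distr M T V)" .
  have 2: "(\<integral>v. ?g (u, v) \<partial>distr M T V) = N u * max_cdf \<gamma> (s + d) (L u)" for u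
  proof -
    have "(\<integral>v. ?g (u, v) \<partial>distr M T V) = expectation (\<lambda>\<omega>. N u * max_cdf \<gamma> s (L u - \<gamma> * d - p (V \<omega>)))"
      by (subst integral_distr) auto
    also have "\<dots> = N u * expectation (\<lambda>\<omega>. max_cdf \<gamma> s (L u - \<gamma> * d - p (V \<omega>)))"
      by simp
    also have "expectation (\<lambda>\<omega>. max_cdf \<gamma> s (L u - \<gamma> * d - p (V \<omega>))) = max_cdf \<gamma> (s + d) (L u)"
      unfolding max_cdf_semigroup[OF assms(7,8), symmetric]
      using distributed_integral[OF V, of "\<lambda>v. max_cdf \<gamma> s (L u - \<gamma> * d - v)"] by simp
    finally show ?thesis .
  qed
  show ?thesis using 1 unfolding 2 by simp
qed


section \<open>Optional stopping on a grid\<close>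

text \<open>For \<open>x 0 \<le> a\<close>, the value of \<open>z\<close> at the first index where \<open>x\<close> exceeds \<open>a\<close>, or at \<open>n\<close> if that comes
earlier. Written as a martingale transform so that its expectation can be taken term by term.\<close>

definition stopped_sum :: "real \<Rightarrow> (nat \<Rightarrow> real) \<Rightarrow> (nat \<Rightarrow> real) \<Rightarrow> nat \<Rightarrow> real" where
  "stopped_sum a x z n = z 0 + (\<Sum>k<n. of_bool (\<forall>j\<le>k. x j \<le> a) * (z (Suc k) - z k))"

lemma stopped_sum_cases:
  assumes "x 0 \<le> a"
  shows "(\<forall>j\<le>n. x j \<le> a) \<and> stopped_sum a x z n = z n \<or>
     (\<exists>k<n. x k \<le> a \<and> a < x (Suc k) \<and> stopped_sum a x z n = z (Suc k))"
proof (induction n)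
  case 0
  then show ?case using assms by (simp add: stopped_sum_def)
next
  case (Suc n)
  have step: "stopped_sum a x z (Suc n) = stopped_sum a x z n + of_bool (\<forall>j\<le>n. x j \<le> a) * (z (Suc n) - z n)"
    by (simp add: stopped_sum_def)
  from Suc show ?case
  proof (elim disjE conjE exE)
    assume "\<forall>j\<le>n. x j \<le> a" "stopped_sum a x z n = z n"
    then show ?thesis
      unfolding step by (cases "x (Suc n) \<le> a") (auto simp: le_Suc_eq intro!: exI[of _ n])
  next
    fix k assume k: "k < n" "x k \<le> a" "a < x (Suc k)" "stopped_sum a x z n = z (Suc k)"
    then have "\<not> (\<forall>j\<le>n. x j \<le> a)" by (auto simp: not_le intro!: exI[of _ "Suc k"])
    then show ?thesis
      unfolding step using k by (auto intro!: exI[of _ k])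
  qed
qed

lemma stopped_sum_bound:
  assumes "x 0 \<le> a" "\<And>k. \<bar>z k\<bar> \<le> c"
  shows "\<bar>stopped_sum a x z n\<bar> \<le> c"
  using stopped_sum_cases[of x a n z] assms by auto

lemma pred_all_le:
  fixes X :: "nat \<Rightarrow> 'a \<Rightarrow> real"
  assumes "\<And>j. j \<le> k \<Longrightarrow> X j \<in> borel_measurable M"
  shows "Measurable.pred M (\<lambda>\<omega>. \<forall>j\<le>k. X j \<omega> \<le> a)"
proof -
  have "Measurable.pred M (\<lambda>\<omega>. \<forall>j\<in>{..k}. X j \<omega> \<le> a)"
  proof (intro pred_intros_finite)
    fix j assume "j \<in> {..k}"
    then have [measurable]: "X j \<in> borel_measurable M" using assms by simp
    show "Measurable.pred M (\<lambda>\<omega>. X j \<omega> \<le> a)" by measurable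
  qed simp
  then show ?thesis by (simp only: Ball_def atMost_iff)
qed

lemma of_bool_measurable:
  assumes [measurable]: "Measurable.pred M P"
  shows "(\<lambda>\<omega>. of_bool (P \<omega>) :: real) \<in> borel_measurable M"
  unfolding of_bool_def by measurable

lemma stopped_sum_measurable:
  fixes X Z :: "nat \<Rightarrow> 'a \<Rightarrow> real"
  assumes "\<And>k. X k \<in> borel_measurable M" "\<And>k. Z k \<in> borel_measurable M"
  shows "(\<lambda>\<omega>. stopped_sum a (\<lambda>k. X k \<omega>) (\<lambda>k. Z k \<omega>) n) \<in> borel_measurable M"
  unfolding stopped_sum_def
  by (intro borel_measurable_add borel_measurable_sum borel_measurable_times borel_measurable_diff
      of_bool_measurable pred_all_le assms)

text \<open>Optional stopping. The increments \<open>Y\<close> generate the walk \<open>X\<close> with drift, and the remaining time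
\<open>(n - k) * d + \<epsilon>\<close> in \<open>Z\<close> makes every term of the martingale transform have mean 0.\<close>

lemma (in prob_space) expectation_stopped_sum:
  fixes a :: real
  assumes indep: "indep_vars (\<lambda>_. borel) Y {..<n}"
    and Y: "\<And>i. i < n \<Longrightarrow> distributed M lborel (Y i) (normal_density 0 (sqrt d))"
    and "d > 0" "\<epsilon> > 0" "\<gamma> \<ge> 0"
  defines "X \<equiv> \<lambda>k \<omega>. (\<Sum>i<k. Y i \<omega>) + \<gamma> * (real k * d)"
  defines "Z \<equiv> \<lambda>k \<omega>. max_cdf \<gamma> (real (n - k) * d + \<epsilon>) (a - X k \<omega>)"
  shows "expectation (\<lambda>\<omega>. stopped_sum a (\<lambda>k. X k \<omega>) (\<lambda>k. Z k \<omega>) n) = max_cdf \<gamma> (real n * d + \<epsilon>) a"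
proof -
  have Ym: "Y i \<in> borel_measurable M" if "i < n" for i
    using indep that unfolding indep_vars_def by auto
  have Xm: "X k \<in> borel_measurable M" if "k \<le> n" for k
    unfolding X_def using that Ym by (intro borel_measurable_add borel_measurable_sum) auto
  have Zm: "Z k \<in> borel_measurable M" if "k \<le> n" for k
    unfolding Z_def by (intro measurable_heat_functions borel_measurable_diff Xm that) auto
  have Zb: "\<bar>Z k \<omega>\<bar> \<le> 1" for k \<omega>
    unfolding Z_def using assms(3-5) by (intro max_cdf_bound) (auto intro: add_nonneg_pos)
  let ?N = "\<lambda>k \<omega>. of_bool (\<forall>j\<le>k. X j \<omega> \<le> a) :: real"
  have Nm: "?N k \<in> borel_measurable M" if "k \<le> n" for k
    using Xm that by (intro of_bool_measurable pred_all_le) auto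
  have int: "integrable M (\<lambda>\<omega>. ?N k \<omega> * Z j \<omega>)" if "k \<le> n" "j \<le> n" for k j
    using Zb by (intro integrable_const_bound[where B=1] borel_measurable_times Nm Zm that) auto
  have step: "expectation (\<lambda>\<omega>. ?N k \<omega> * Z (Suc k) \<omega>) = expectation (\<lambda>\<omega>. ?N k \<omega> * Z k \<omega>)" if k: "k < n" for k
  proof -
    let ?S = "PiM {..<k} (\<lambda>_. borel :: real measure)"
    let ?U = "\<lambda>\<omega>. restrict (\<lambda>i. Y i \<omega>) {..<k}"
    let ?X = "\<lambda>j u. (\<Sum>i<j. u i) + \<gamma> * (real j * d) :: real"
    let ?s = "real (n - Suc k) * d + \<epsilon>"
    have ind: "indep_var ?S ?U (PiM {k} (\<lambda>_. borel)) (\<lambda>\<omega>. restrict (\<lambda>i. Y i \<omega>) {k})"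
      using k by (intro indep_var_restrict[OF indep]) auto
    have pm: "(\<lambda>v. v k) \<in> borel_measurable (PiM {k} (\<lambda>_. borel :: real measure))"
      by (rule measurable_component_singleton) simp
    have Xu: "?X j \<in> borel_measurable ?S" if "j \<le> k" for j
      using that by (intro borel_measurable_add borel_measurable_sum measurable_component_singleton) auto
    have Num: "(\<lambda>u. of_bool (\<forall>j\<le>k. ?X j u \<le> a) :: real) \<in> borel_measurable ?S"
      using Xu by (intro of_bool_measurable pred_all_le)
    have Lm: "(\<lambda>u. a - ?X k u) \<in> borel_measurable ?S"
      using Xu[OF order_refl] by (intro borel_measurable_diff) auto
    have Vd: "distributed M lborel (\<lambda>\<omega>. restrict (\<lambda>i. Y i \<omega>) {k} k) (normal_density 0 (sqrt d))"
      using Y[OF k] by simp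
    have X_Suc: "a - X (Suc k) \<omega> = a - X k \<omega> - \<gamma> * d - Y k \<omega>" for \<omega>
      by (simp add: X_def algebra_simps)
    from max_cdf_conditional_step[OF ind Vd Num Lm pm, of ?s \<gamma>]
    have "expectation (\<lambda>\<omega>. of_bool (\<forall>j\<le>k. ?X j (?U \<omega>) \<le> a) * max_cdf \<gamma> ?s (a - ?X k (?U \<omega>) - \<gamma> * d - restrict (\<lambda>i. Y i \<omega>) {k} k)) =
      expectation (\<lambda>\<omega>. of_bool (\<forall>j\<le>k. ?X j (?U \<omega>) \<le> a) * max_cdf \<gamma> (?s + d) (a - ?X k (?U \<omega>)))"
      using assms(3-5) by (simp add: add_nonneg_pos del: restrict_apply restrict_apply')
    moreover have "restrict (\<lambda>i. Y i \<omega>) {k} k = Y k \<omega>" for \<omega>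
      by simp
    moreover have "?X j (?U \<omega>) = X j \<omega>" if "j \<le> k" for j \<omega>
      unfolding X_def using that by (auto intro!: sum.cong)
    moreover have "?s + d = real (n - k) * d + \<epsilon>"
      using k by (simp add: of_nat_diff algebra_simps)
    ultimately show ?thesis
      unfolding Z_def X_Suc by (simp cong: conj_cong)
  qed
  have "expectation (\<lambda>\<omega>. stopped_sum a (\<lambda>k. X k \<omega>) (\<lambda>k. Z k \<omega>) n) =
     expectation (\<lambda>\<omega>. Z 0 \<omega> + (\<Sum>k<n. ?N k \<omega> * Z (Suc k) \<omega> - ?N k \<omega> * Z k \<omega>))"
    by (simp add: stopped_sum_def right_diff_distrib)
  also have "\<dots> = expectation (Z 0) + (\<Sum>k<n. expectation (\<lambda>\<omega>. ?N k \<omega> * Z (Suc k) \<omega>) - expectation (\<lambda>\<omega>. ?N k \<omega> * Z k \<omega>))"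
  proof -
    have int0: "integrable M (Z 0)"
      using Zb by (intro integrable_const_bound[where B=1] Zm) auto
    have intd: "integrable M (\<lambda>\<omega>. ?N k \<omega> * Z (Suc k) \<omega> - ?N k \<omega> * Z k \<omega>)" if "k < n" for k
      using that by (intro Bochner_Integration.integrable_diff int) auto
    have "expectation (\<lambda>\<omega>. Z 0 \<omega> + (\<Sum>k<n. ?N k \<omega> * Z (Suc k) \<omega> - ?N k \<omega> * Z k \<omega>)) =
      expectation (Z 0) + expectation (\<lambda>\<omega>. \<Sum>k<n. ?N k \<omega> * Z (Suc k) \<omega> - ?N k \<omega> * Z k \<omega>)"
      by (rule Bochner_Integration.integral_add[OF int0 Bochner_Integration.integrable_sum]) (rule intd, simp)
    also have "expectation (\<lambda>\<omega>. \<Sum>k<n. ?N k \<omega> * Z (Suc k) \<omega> - ?N k \<omega> * Z k \<omega>) =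
      (\<Sum>k<n. expectation (\<lambda>\<omega>. ?N k \<omega> * Z (Suc k) \<omega> - ?N k \<omega> * Z k \<omega>))"
      by (rule Bochner_Integration.integral_sum) (rule intd, simp)
    also have "\<dots> = (\<Sum>k<n. expectation (\<lambda>\<omega>. ?N k \<omega> * Z (Suc k) \<omega>) - expectation (\<lambda>\<omega>. ?N k \<omega> * Z k \<omega>))"
      by (intro sum.cong refl Bochner_Integration.integral_diff int) auto
    finally show ?thesis .
  qed
  also have "\<dots> = expectation (Z 0)"
  proof -
    have "(\<Sum>k<n. expectation (\<lambda>\<omega>. ?N k \<omega> * Z (Suc k) \<omega>) - expectation (\<lambda>\<omega>. ?N k \<omega> * Z k \<omega>)) = 0"
      by (intro sum.neutral ballI) (simp only: lessThan_iff step diff_self)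
    then show ?thesis by simp
  qed
  also have "\<dots> = max_cdf \<gamma> (real n * d + \<epsilon>) a"
    by (simp add: Z_def X_def prob_space)
  finally show ?thesis .
qed

section \<open>Continuous paths seen on finer and finer grids\<close>

lemma grid_point_in_interval:
  assumes "k \<le> Suc n" "t > 0"
  shows "real k * (t / Suc n) \<in> {0..t}"
proof -
  have "real k * (t / Suc n) \<le> real (Suc n) * (t / Suc n)"
    using assms by (intro mult_right_mono) auto
  then show ?thesis using assms by simp
qed

lemma grid_point_near:
  fixes n :: nat
  assumes "0 \<le> s" "s \<le> t" "n > 0" "t > 0"
  obtains k where "k \<le> n" "\<bar>real k * (t / n) - s\<bar> \<le> t / n"
proof
  define d where "d = t / real n"
  have d: "d > 0" "real n * d = t" using assms by (auto simp: d_def)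
  have fl: "real (nat \<lfloor>s / d\<rfloor>) = of_int \<lfloor>s / d\<rfloor>"
    using assms d by simp
  have "s / d \<le> n"
    using assms d by (simp add: field_simps)
  then have "of_int \<lfloor>s / d\<rfloor> \<le> real n" by linarith
  then show "nat \<lfloor>s / d\<rfloor> \<le> n" using fl by linarith
  have "of_int \<lfloor>s / d\<rfloor> * d \<le> s"
    by (rule pos_le_divide_eq[OF d(1), THEN iffD1]) (rule of_int_floor_le)
  moreover have "s \<le> (of_int \<lfloor>s / d\<rfloor> + 1) * d"
    by (rule pos_divide_le_eq[OF d(1), THEN iffD1]) linarith
  ultimately have "of_int \<lfloor>s / d\<rfloor> * d \<le> s" "s \<le> of_int \<lfloor>s / d\<rfloor> * d + d"
    by (simp_all add: distrib_right)
  then show "\<bar>real (nat \<lfloor>s / d\<rfloor>) * (t / n) - s\<bar> \<le> t / n"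
    unfolding fl d_def[symmetric] by linarith
qed

lemma grid_detects_crossing:
  fixes x :: "real \<Rightarrow> real"
  assumes "continuous_on {0..t} x" "t > 0" "s \<in> {0..t}" "x s > a"
  shows "\<forall>\<^sub>F n in sequentially. \<exists>k\<le>Suc n. x (real k * (t / Suc n)) > a"
proof -
  obtain d where d: "d > 0" "\<And>s'. s' \<in> {0..t} \<Longrightarrow> \<bar>s' - s\<bar> < d \<Longrightarrow> \<bar>x s' - x s\<bar> < x s - a"
    using assms(1,3,4) unfolding continuous_on_iff dist_real_def by (metis diff_gt_0_iff_gt)
  have "(\<lambda>n. t / real (Suc n)) \<longlonglongrightarrow> 0"
    by real_asymp
  then have "\<forall>\<^sub>F n in sequentially. t / real (Suc n) < d"
    using d(1) by (rule order_tendstoD)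
  then show ?thesis
  proof eventually_elim
    case (elim n)
    obtain k where k: "k \<le> Suc n" "\<bar>real k * (t / Suc n) - s\<bar> \<le> t / Suc n"
      using grid_point_near[of s t "Suc n"] assms by auto
    from grid_point_in_interval[OF k(1) assms(2)]
    have "\<bar>x (real k * (t / Suc n)) - x s\<bar> < x s - a"
      using k elim by (intro d(2)) auto
    then show ?case using k(1) by (intro exI[of _ k]) linarith
  qed
qed

lemma grid_increments_small:
  fixes x :: "real \<Rightarrow> real"
  assumes "continuous_on {0..t} x" "t > 0" "e > 0"
  shows "\<forall>\<^sub>F n in sequentially. \<forall>k<Suc n. \<bar>x (real (Suc k) * (t / Suc n)) - x (real k * (t / Suc n))\<bar> < e"
proof -
  have "uniformly_continuous_on {0..t} x"
    using assms(1) by (intro compact_uniformly_continuous) auto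
  then obtain d where d: "d > 0" "\<And>s s'. s \<in> {0..t} \<Longrightarrow> s' \<in> {0..t} \<Longrightarrow> \<bar>s' - s\<bar> < d \<Longrightarrow> \<bar>x s' - x s\<bar> < e"
    using assms(3) unfolding uniformly_continuous_on_def dist_real_def by metis
  have "(\<lambda>n. t / real (Suc n)) \<longlonglongrightarrow> 0"
    by real_asymp
  then have "\<forall>\<^sub>F n in sequentially. t / real (Suc n) < d"
    using d(1) by (rule order_tendstoD)
  then show ?thesis
  proof eventually_elim
    case (elim n)
    show ?case
    proof (intro allI impI)
      fix k assume k: "k < Suc n"
      have "real (Suc k) * q - real k * q = q" for q
        by (simp add: algebra_simps)
      then have "\<bar>real (Suc k) * (t / Suc n) - real k * (t / Suc n)\<bar> = t / Suc n"
        using assms(2) by (simp only:) simp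
      then show "\<bar>x (real (Suc k) * (t / Suc n)) - x (real k * (t / Suc n))\<bar> < e"
        using k elim by (intro d(2) grid_point_in_interval assms(2)) linarith+
    qed
  qed
qed

text \<open>A path that never exceeds \<open>a\<close> at a grid point is not stopped and ends at the value \<open>max_cdf \<gamma> \<epsilon> (a - x t)\<close>
for every grid. A path that exceeds \<open>a\<close> is stopped on every fine grid, with an overshoot of at most one
increment, which uniform continuity makes small; there \<open>max_cdf_overshoot\<close> applies.\<close>

lemma stopped_sum_grid_limit:
  fixes x :: "real \<Rightarrow> real"
  assumes cont: "continuous_on {0..t} x" and "t > 0" "x 0 \<le> a" "\<epsilon> > 0" "\<gamma> \<ge> 0"
  shows "(\<lambda>n. stopped_sum a (\<lambda>k. x (real k * (t / Suc n)))
      (\<lambda>k. max_cdf \<gamma> (real (Suc n - k) * (t / Suc n) + \<epsilon>) (a - x (real k * (t / Suc n)))) (Suc n))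
    \<longlonglongrightarrow> of_bool (\<forall>n. \<forall>k\<le>Suc n. x (real k * (t / Suc n)) \<le> a) * max_cdf \<gamma> \<epsilon> (a - x t)" (is "?V \<longlonglongrightarrow> _")
proof (cases "\<forall>n. \<forall>k\<le>Suc n. x (real k * (t / Suc n)) \<le> a")
  case True
  have "?V n = max_cdf \<gamma> \<epsilon> (a - x t)" for n
  proof -
    have no: "\<not> a < x (real (Suc k) * (t / Suc n))" if "k < Suc n" for k
      using True that by (metis Suc_leI not_le)
    have "real (Suc n) * (t / Suc n) = t" by simp
    then show ?thesis
      using stopped_sum_cases[of "\<lambda>k. x (real k * (t / Suc n))" a "Suc n"
          "\<lambda>k. max_cdf \<gamma> (real (Suc n - k) * (t / Suc n) + \<epsilon>) (a - x (real k * (t / Suc n)))"] assms(3) no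
      by (auto simp del: of_nat_Suc)
  qed
  with True show ?thesis by simp
next
  case False
  then obtain m k where "k \<le> Suc m" "x (real k * (t / Suc m)) > a"
    by (auto simp: not_le)
  then have cross: "\<forall>\<^sub>F n in sequentially. \<exists>k\<le>Suc n. x (real k * (t / Suc n)) > a"
    using grid_detects_crossing[OF cont assms(2) grid_point_in_interval[OF _ assms(2)]] by blast
  define C where "C = 2 / sqrt (2 * pi * \<epsilon>) + 2 * \<gamma>"
  have C: "C > 0" unfolding C_def using assms(4,5) by (intro add_pos_nonneg) auto
  have "?V \<longlonglongrightarrow> 0"
  proof (rule LIMSEQ_I)
    fix e :: real assume "e > 0"
    then have "e / C > 0" using C by simp
    from cross grid_increments_small[OF cont assms(2) this]
    have "\<forall>\<^sub>F n in sequentially. norm (?V n - 0) < e"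
    proof eventually_elim
      case (elim n)
      then obtain k where k: "k < Suc n" "x (real k * (t / Suc n)) \<le> a" "a < x (real (Suc k) * (t / Suc n))"
        "?V n = max_cdf \<gamma> (real (Suc n - Suc k) * (t / Suc n) + \<epsilon>) (a - x (real (Suc k) * (t / Suc n)))"
        using stopped_sum_cases[of "\<lambda>k. x (real k * (t / Suc n))" a "Suc n"
          "\<lambda>k. max_cdf \<gamma> (real (Suc n - k) * (t / Suc n) + \<epsilon>) (a - x (real k * (t / Suc n)))"] assms(3)
        by (auto simp del: of_nat_Suc simp: not_less[symmetric])
      let ?y = "x (real (Suc k) * (t / Suc n)) - a"
      have "\<bar>?V n\<bar> \<le> C * ?y"
        using max_cdf_overshoot[OF assms(4) _ assms(5), of "real (Suc n - Suc k) * (t / Suc n) + \<epsilon>" ?y] k assms(2)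
        unfolding C_def by (simp del: of_nat_Suc diff_Suc_Suc)
      also have "?y \<le> \<bar>x (real (Suc k) * (t / Suc n)) - x (real k * (t / Suc n))\<bar>"
        using k by linarith
      also have "\<dots> < e / C"
        using elim k by blast
      finally show ?case using C by (simp add: field_simps)
    qed
    then show "\<exists>no. \<forall>n\<ge>no. norm (?V n - 0) < e"
      by (simp only: eventually_sequentially)
  qed
  then show ?thesis
    by (simp only: False of_bool_eq mult_zero_left)
qed


lemma continuous_le_on_grid_iff:
  fixes x :: "real \<Rightarrow> real"
  assumes "continuous_on {0..t} x" "t > 0"
  shows "(\<forall>s\<in>{0..t}. x s \<le> a) \<longleftrightarrow> (\<forall>n. \<forall>k\<le>Suc n. x (real k * (t / Suc n)) \<le> a)"
proof (intro iffI allI impI ballI)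
  fix n k assume le: "\<forall>s\<in>{0..t}. x s \<le> a" and "k \<le> Suc n"
  with grid_point_in_interval[OF _ assms(2)]
  have "real k * (t / Suc n) \<in> {0..t}" by blast
  with le show "x (real k * (t / Suc n)) \<le> a" by blast
next
  fix s assume grid: "\<forall>n. \<forall>k\<le>Suc n. x (real k * (t / Suc n)) \<le> a" and "s \<in> {0..t}"
  show "x s \<le> a"
  proof (rule ccontr)
    assume "\<not> x s \<le> a"
    then have "\<forall>\<^sub>F n in sequentially. \<exists>k\<le>Suc n. x (real k * (t / Suc n)) > a"
      using grid_detects_crossing[OF assms \<open>s \<in> {0..t}\<close>] by simp
    then obtain n k where "k \<le> Suc n" "x (real k * (t / Suc n)) > a"
      by (auto simp: eventually_sequentially)
    with grid show False by (meson not_le)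
  qed
qed

section \<open>The maximum of Brownian motion with drift\<close>

lemma drifted_brownian_grid_expectation:
  assumes BM: "standard_brownian_motion M B" and "t > 0" "\<epsilon> > 0" "\<gamma> \<ge> 0"
  shows "(\<integral>\<omega>. stopped_sum a (\<lambda>k. B (real k * (t / Suc n)) \<omega> - B 0 \<omega> + \<gamma> * (real k * (t / Suc n)))
     (\<lambda>k. max_cdf \<gamma> (real (Suc n - k) * (t / Suc n) + \<epsilon>)
        (a - (B (real k * (t / Suc n)) \<omega> - B 0 \<omega> + \<gamma> * (real k * (t / Suc n))))) (Suc n) \<partial>M) = max_cdf \<gamma> (t + \<epsilon>) a"
proof -
  interpret prob_space M using BM by (simp add: standard_brownian_motion_def)
  define d where "d = t / real (Suc n)"
  have d: "d > 0" "real (Suc n) * d = t"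
    using assms(2) by (simp_all add: d_def)
  define Y where "Y i \<omega> = B (real (Suc i) * d) \<omega> - B (real i * d) \<omega>" for i \<omega>
  have "indep_vars (\<lambda>_. borel) (\<lambda>i \<omega>. B (real (Suc i) * d) \<omega> - B (real i * d) \<omega>) {..<Suc n}"
    using BM d(1) unfolding standard_brownian_motion_def
    by (elim conjE allE[where P="\<lambda>n. \<forall>\<tau>. _ n \<tau>"] allE[where x="\<lambda>i. real i * d"]) auto
  then have indep: "indep_vars (\<lambda>_. borel) Y {..<Suc n}"
    by (simp add: Y_def[abs_def])
  have Y: "distributed M lborel (Y i) (normal_density 0 (sqrt d))" for i
  proof -
    have "0 \<le> real i * d" "real i * d < real (Suc i) * d"
      using d(1) by auto
    moreover have "real (Suc i) * d - real i * d = d"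
      by (simp add: algebra_simps)
    ultimately show ?thesis
      using BM unfolding standard_brownian_motion_def Y_def[abs_def] by metis
  qed
  have sum: "(\<Sum>i<k. Y i \<omega>) = B (real k * d) \<omega> - B 0 \<omega>" for k \<omega>
    unfolding Y_def using sum_lessThan_telescope[of "\<lambda>i. B (real i * d) \<omega>" k] by simp
  show ?thesis
    using expectation_stopped_sum[OF indep Y d(1) assms(3,4), of a, unfolded sum d(2)] unfolding d_def .
qed

text \<open>The mesh tends to 0 with \<open>\<epsilon>\<close> fixed; dominated convergence applies since \<open>max_cdf\<close> is bounded by 1.
The event is stated on grid points, which makes its measurability evident;
\<open>continuous_le_on_grid_iff\<close> identifies it with staying below \<open>a\<close> on \<open>[0, t]\<close>.\<close>

lemma drifted_brownian_event_expectation: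
  assumes BM: "standard_brownian_motion M B" and "t > 0" "\<epsilon> > 0" "\<gamma> \<ge> 0" "a > 0"
  defines "X \<equiv> \<lambda>s \<omega>. B s \<omega> - B 0 \<omega> + \<gamma> * s"
  shows "(\<integral>\<omega>. of_bool (\<forall>n. \<forall>k\<le>Suc n. X (real k * (t / Suc n)) \<omega> \<le> a) * max_cdf \<gamma> \<epsilon> (a - X t \<omega>) \<partial>M) = max_cdf \<gamma> (t + \<epsilon>) a"
proof -
  interpret prob_space M using BM by (simp add: standard_brownian_motion_def)
  have Bm: "B s \<in> borel_measurable M" if "s \<ge> 0" for s
    using BM that by (simp add: standard_brownian_motion_def)
  have Xm: "X s \<in> borel_measurable M" if "s \<ge> 0" for s
    unfolding X_def using that by (intro borel_measurable_add borel_measurable_diff Bm) auto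
  have cont: "AE \<omega> in M. continuous_on {0..} (\<lambda>t. B t \<omega>)"
    using BM by (simp add: standard_brownian_motion_def)
  let ?V = "\<lambda>n \<omega>. stopped_sum a (\<lambda>k. X (real k * (t / Suc n)) \<omega>)
      (\<lambda>k. max_cdf \<gamma> (real (Suc n - k) * (t / Suc n) + \<epsilon>) (a - X (real k * (t / Suc n)) \<omega>)) (Suc n)"
  let ?L = "\<lambda>\<omega>. of_bool (\<forall>n. \<forall>k\<le>Suc n. X (real k * (t / Suc n)) \<omega> \<le> a) * max_cdf \<gamma> \<epsilon> (a - X t \<omega>)"
  have grid_pos: "0 \<le> real k * (t / Suc n)" for k n
    using assms(2) by simp
  have "(\<lambda>\<omega>. of_bool (\<forall>n. \<forall>k\<le>Suc n. X (real k * (t / Suc n)) \<omega> \<le> a) :: real) \<in> borel_measurable M"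
    by (intro of_bool_measurable pred_intros_countable pred_all_le Xm grid_pos)
  moreover have "(\<lambda>\<omega>. max_cdf \<gamma> \<epsilon> (a - X t \<omega>)) \<in> borel_measurable M"
    using assms(2) by (intro measurable_heat_functions borel_measurable_diff borel_measurable_const Xm) simp
  ultimately have Lm: "?L \<in> borel_measurable M"
    by (rule borel_measurable_times)
  have Vm: "?V n \<in> borel_measurable M" for n
    by (intro stopped_sum_measurable Xm grid_pos measurable_heat_functions borel_measurable_diff borel_measurable_const)
  have "(\<lambda>n. expectation (?V n)) \<longlonglongrightarrow> expectation ?L"
  proof (rule integral_dominated_convergence[where w="\<lambda>_. 1"])
    show "AE \<omega> in M. (\<lambda>n. ?V n \<omega>) \<longlonglongrightarrow> ?L \<omega>"
      using cont
    proof eventually_elim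
      case (elim \<omega>)
      have "continuous_on {0..t} (\<lambda>s. X s \<omega>)"
        unfolding X_def using elim by (intro continuous_intros) (auto intro: continuous_on_subset)
      then show ?case
        using assms(2-5) by (intro stopped_sum_grid_limit) (auto simp: X_def)
    qed
    show "AE \<omega> in M. norm (?V n \<omega>) \<le> 1" for n
    proof (rule AE_I2)
      fix \<omega>
      show "norm (?V n \<omega>) \<le> 1"
        unfolding real_norm_def
      proof (rule stopped_sum_bound)
        show "X (real 0 * (t / Suc n)) \<omega> \<le> a" using assms(5) by (simp add: X_def)
        show "\<bar>max_cdf \<gamma> (real (Suc n - k) * (t / Suc n) + \<epsilon>) y\<bar> \<le> 1" for k y
          using assms(2-4) by (intro max_cdf_bound add_nonneg_pos) auto
      qed
    qed
  qed (rule Lm, rule Vm, simp)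
  moreover have "expectation (?V n) = max_cdf \<gamma> (t + \<epsilon>) a" for n
    unfolding X_def by (rule drifted_brownian_grid_expectation[OF assms(1-4)])
  ultimately show ?thesis
    by (simp add: LIMSEQ_const_iff)
qed

text \<open>Now \<open>\<epsilon>\<close> tends to 0. On the event, \<open>X t < a\<close> almost surely because \<open>X t\<close> has no atom at \<open>a\<close>, so the
integrand tends to the indicator of the event.\<close>

lemma drifted_brownian_max_cdf:
  assumes BM: "standard_brownian_motion M B" and "t > 0" "\<gamma> \<ge> 0" "a > 0"
  defines "X \<equiv> \<lambda>s \<omega>. B s \<omega> - B 0 \<omega> + \<gamma> * s"
  shows "measure M {\<omega> \<in> space M. \<forall>n. \<forall>k\<le>Suc n. X (real k * (t / Suc n)) \<omega> \<le> a} = max_cdf \<gamma> t a"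
proof -
  interpret prob_space M using BM by (simp add: standard_brownian_motion_def)
  have Bm: "B s \<in> borel_measurable M" if "s \<ge> 0" for s
    using BM that by (simp add: standard_brownian_motion_def)
  have Xm: "X s \<in> borel_measurable M" if "s \<ge> 0" for s
    unfolding X_def using that by (intro borel_measurable_add borel_measurable_diff Bm) auto
  have grid_pos: "0 \<le> real k * (t / Suc n)" for k n
    using assms(2) by simp
  define P where "P \<omega> \<longleftrightarrow> (\<forall>n. \<forall>k\<le>Suc n. X (real k * (t / Suc n)) \<omega> \<le> a)" for \<omega>
  have Pm: "(\<lambda>\<omega>. of_bool (P \<omega>) :: real) \<in> borel_measurable M"
    unfolding P_def by (intro of_bool_measurable pred_intros_countable pred_all_le Xm grid_pos)
  have Xtm: "X t \<in> borel_measurable M"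
    using assms(2) by (intro Xm) simp
  have ne: "AE \<omega> in M. X t \<omega> \<noteq> a"
  proof -
    have D: "distributed M lborel (\<lambda>\<omega>. B t \<omega> - B 0 \<omega>) (normal_density 0 (sqrt (t - 0)))"
      using BM assms(2) unfolding standard_brownian_motion_def by blast
    have "emeasure M ((\<lambda>\<omega>. B t \<omega> - B 0 \<omega>) -` {a - \<gamma> * t} \<inter> space M) =
       (\<integral>\<^sup>+x. ennreal (normal_density 0 (sqrt (t - 0)) x) * indicator {a - \<gamma> * t} x \<partial>lborel)"
      by (rule distributed_emeasure[OF D]) simp
    also have "\<dots> = 0"
      by (subst nn_integral_indicator_singleton) simp_all
    finally show ?thesis
      by (intro AE_I[where N="(\<lambda>\<omega>. B t \<omega> - B 0 \<omega>) -` {a - \<gamma> * t} \<inter> space M"])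
         (use D distributed_measurable[OF D] in \<open>auto simp: X_def intro: measurable_sets\<close>)
  qed
  define \<epsilon> where "\<epsilon> m = 1 / real (Suc m)" for m
  have \<epsilon>: "\<epsilon> m > 0" for m by (simp add: \<epsilon>_def)
  have \<epsilon>0: "filterlim \<epsilon> (at_right 0) sequentially"
    unfolding \<epsilon>_def by real_asymp
  have "(\<lambda>m. expectation (\<lambda>\<omega>. of_bool (P \<omega>) * max_cdf \<gamma> (\<epsilon> m) (a - X t \<omega>))) \<longlonglongrightarrow> expectation (\<lambda>\<omega>. of_bool (P \<omega>))"
  proof (rule integral_dominated_convergence[where w="\<lambda>_. 1"])
    show "AE \<omega> in M. (\<lambda>m. of_bool (P \<omega>) * max_cdf \<gamma> (\<epsilon> m) (a - X t \<omega>)) \<longlonglongrightarrow> of_bool (P \<omega>)"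
      using ne
    proof eventually_elim
      case (elim \<omega>)
      show ?case
      proof (cases "P \<omega>")
        case True
        then have "X (real (Suc 0) * (t / Suc 0)) \<omega> \<le> a" unfolding P_def by blast
        with elim have "a - X t \<omega> > 0" by simp
        from filterlim_compose[OF max_cdf_at_time_0[OF this] \<epsilon>0] True
        show ?thesis by simp
      next
        case False
        then show ?thesis by (simp only: of_bool_eq mult_zero_left tendsto_const)
      qed
    qed
    show "AE \<omega> in M. norm (of_bool (P \<omega>) * max_cdf \<gamma> (\<epsilon> m) (a - X t \<omega>)) \<le> 1" for m
      using max_cdf_bound[OF \<epsilon> assms(3)] by (intro AE_I2) (auto simp: abs_mult)
    show "(\<lambda>\<omega>. of_bool (P \<omega>) * max_cdf \<gamma> (\<epsilon> m) (a - X t \<omega>)) \<in> borel_measurable M" for m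
      by (intro borel_measurable_times Pm measurable_heat_functions borel_measurable_diff borel_measurable_const Xtm)
  qed (rule Pm, simp)
  moreover have "expectation (\<lambda>\<omega>. of_bool (P \<omega>) * max_cdf \<gamma> (\<epsilon> m) (a - X t \<omega>)) = max_cdf \<gamma> (t + \<epsilon> m) a" for m
    unfolding P_def X_def by (rule drifted_brownian_event_expectation[OF BM assms(2) \<epsilon> assms(3,4)])
  moreover have "(\<lambda>m. max_cdf \<gamma> (t + \<epsilon> m) a) \<longlonglongrightarrow> max_cdf \<gamma> t a"
  proof (rule isCont_tendsto_compose[OF max_cdf_cont_time[OF assms(2)]])
    show "(\<lambda>m. t + \<epsilon> m) \<longlonglongrightarrow> t"
      unfolding \<epsilon>_def by real_asymp
  qed
  ultimately have "expectation (\<lambda>\<omega>. of_bool (P \<omega>)) = max_cdf \<gamma> t a"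
    by (simp add: LIMSEQ_unique)
  moreover have "expectation (\<lambda>\<omega>. of_bool (P \<omega>)) = expectation (indicat_real {\<omega> \<in> space M. P \<omega>})"
    by (intro Bochner_Integration.integral_cong) (auto simp: indicator_def)
  moreover have "expectation (indicat_real {\<omega> \<in> space M. P \<omega>}) = prob {\<omega> \<in> space M. P \<omega>}"
    by (simp add: Int_absorb2 subset_eq)
  ultimately have "prob {\<omega> \<in> space M. P \<omega>} = max_cdf \<gamma> t a" by (simp only:)
  then show ?thesis unfolding P_def .
qed

section \<open>The exit time and its density\<close>

text \<open>The levels \<open>u\<close> with \<open>G u > t\<close> are, up to their infimum, those with \<open>X\<close> below \<open>\<delta> u\<close> on \<open>[0, t]\<close>: if
\<open>G u > t\<close> then \<open>X \<le> \<delta> u\<close> there, and if \<open>X < \<delta> u\<close> there then, by continuity at \<open>t\<close>, \<open>X\<close> stays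
below \<open>\<delta> u\<close> for a little longer.\<close>

lemma first_exit_time_le_iff:
  assumes cont: "continuous_on {0..} (\<lambda>s. B s \<omega>)" and "B 0 \<omega> = 0"
    and "\<delta> > 0" "t \<ge> 0" "x > 0"
  shows "first_exit_time (ig_subordinator B \<delta> \<gamma>) t \<omega> \<le> x \<longleftrightarrow> (\<forall>s\<in>{0..t}. B s \<omega> + \<gamma> * s \<le> \<delta> * x)"
proof -
  define X where "X s = B s \<omega> + \<gamma> * s" for s
  define U where "U = {u. u > 0 \<and> ig_subordinator B \<delta> \<gamma> u \<omega> > ereal t}"
  have contX: "continuous_on {0..} X"
    unfolding X_def by (intro continuous_intros cont)
  have below: "X s \<le> \<delta> * u" if "u \<in> U" "s \<in> {0..t}" for u s
  proof (rule ccontr)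
    assume gt: "\<not> X s \<le> \<delta> * u"
    have "u > 0" using that by (simp add: U_def)
    then have "s \<noteq> 0"
      using gt assms(2,3) by (auto simp: X_def)
    then have "ig_subordinator B \<delta> \<gamma> u \<omega> \<le> ereal s"
      unfolding ig_subordinator_def using gt that(2) by (intro INF_lower) (auto simp: X_def)
    then show False
      using that by (auto simp: U_def dest: order.strict_trans2)
  qed
  have above: "u \<in> U" if "u > 0" "\<And>s. s \<in> {0..t} \<Longrightarrow> X s < \<delta> * u" for u
  proof -
    have "X t < \<delta> * u" using that(2) assms(4) by simp
    then obtain d where d: "d > 0" "\<And>s. s \<in> {0..} \<Longrightarrow> \<bar>s - t\<bar> < d \<Longrightarrow> \<bar>X s - X t\<bar> < \<delta> * u - X t"
      using contX assms(4) unfolding continuous_on_iff dist_real_def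
      by (metis atLeast_iff diff_gt_0_iff_gt)
    have "ereal (t + d) \<le> ig_subordinator B \<delta> \<gamma> u \<omega>"
      unfolding ig_subordinator_def
    proof (rule INF_greatest)
      fix s assume s: "s \<in> {s. 0 < s \<and> \<delta> * u < B s \<omega> + \<gamma> * s}"
      then have "s > t" using that(2)[of s] by (force simp: X_def)
      moreover have "\<not> \<bar>s - t\<bar> < d"
        using d(2)[of s] s by (auto simp: X_def)
      ultimately show "ereal (t + d) \<le> ereal s" by simp
    qed
    moreover have "ereal t < ereal (t + d)" using d(1) by simp
    ultimately have "ereal t < ig_subordinator B \<delta> \<gamma> u \<omega>"
      by (rule less_le_trans[rotated])
    then show ?thesis
      using that(1) by (simp add: U_def)
  qed
  have "compact (X ` {0..t})"
    by (intro compact_continuous_image continuous_on_subset[OF contX]) auto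
  then obtain c where c: "\<And>s. s \<in> {0..t} \<Longrightarrow> X s \<le> c"
    using compact_imp_bounded bounded_imp_bdd_above by (meson bdd_above.E image_eqI)
  \<comment> \<open>A level above the maximum \<open>c\<close> of the path on \<open>[0, t]\<close>, so that the infimum is over a nonempty set.\<close>
  have "max 1 ((c + 1) / \<delta>) \<in> U"
  proof (rule above)
    fix s assume "s \<in> {0..t}"
    then have "X s < c + 1" using c by force
    also have "c + 1 = \<delta> * ((c + 1) / \<delta>)" using assms(3) by simp
    also have "\<dots> \<le> \<delta> * max 1 ((c + 1) / \<delta>)" using assms(3) by (intro mult_left_mono) auto
    finally show "X s < \<delta> * max 1 ((c + 1) / \<delta>)" .
  qed simp
  then have ne: "U \<noteq> {}" by blast
  have bdd: "bdd_below U" by (intro bdd_belowI[of _ 0]) (auto simp: U_def)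
  have H: "first_exit_time (ig_subordinator B \<delta> \<gamma>) t \<omega> = Inf U"
    by (simp add: first_exit_time_def U_def)
  show ?thesis unfolding H
  proof
    assume le: "Inf U \<le> x"
    show "\<forall>s\<in>{0..t}. B s \<omega> + \<gamma> * s \<le> \<delta> * x"
    proof
      fix s assume s: "s \<in> {0..t}"
      have "X s / \<delta> \<le> y" if "x < y" for y
      proof -
        have "Inf U < y" using le that by simp
        then obtain u where "u \<in> U" "u < y"
          using cInf_lessD[OF ne] by blast
        then have "X s \<le> \<delta> * y"
          using below[OF _ s] assms(3) by (meson less_imp_le mult_left_mono order_trans)
        then show ?thesis using assms(3) by (simp add: field_simps)
      qed
      then have "X s / \<delta> \<le> x" by (rule dense_ge)
      then show "B s \<omega> + \<gamma> * s \<le> \<delta> * x"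
        using assms(3) by (simp add: X_def field_simps)
    qed
  next
    assume le: "\<forall>s\<in>{0..t}. B s \<omega> + \<gamma> * s \<le> \<delta> * x"
    show "Inf U \<le> x"
    proof (rule dense_ge)
      fix y assume "x < y"
      have "y \<in> U"
      proof (rule above)
        fix s assume "s \<in> {0..t}"
        then have "X s \<le> \<delta> * x" using le by (simp add: X_def)
        also have "\<dots> < \<delta> * y" using \<open>x < y\<close> assms(3) by simp
        finally show "X s < \<delta> * y" .
      qed (use \<open>x < y\<close> assms(5) in simp)
      then show "Inf U \<le> y" by (intro cInf_lower bdd)
    qed
  qed
qed

lemma first_exit_time_cdf:
  assumes BM: "standard_brownian_motion M B" and "\<delta> > 0" "\<gamma> \<ge> 0" "x > 0"
    and H: "H = first_exit_time (ig_subordinator B \<delta> \<gamma>)" and [measurable]: "H t \<in> borel_measurable M"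
  shows "t > 0 \<Longrightarrow> measure M {\<omega> \<in> space M. H t \<omega> \<le> x} = max_cdf \<gamma> t (\<delta> * x)"
    and "t = 0 \<Longrightarrow> measure M {\<omega> \<in> space M. H t \<omega> \<le> x} = 1"
proof -
  interpret prob_space M using BM by (simp add: standard_brownian_motion_def)
  have Bm: "B s \<in> borel_measurable M" if "s \<ge> 0" for s
    using BM that by (simp add: standard_brownian_motion_def)
  have ae: "AE \<omega> in M. continuous_on {0..} (\<lambda>t. B t \<omega>)" "AE \<omega> in M. B 0 \<omega> = 0"
    using BM by (simp_all add: standard_brownian_motion_def)
  {
    assume t: "t > 0"
    define X where "X s \<omega> = B s \<omega> - B 0 \<omega> + \<gamma> * s" for s \<omega>
    have Xm: "X s \<in> borel_measurable M" if "s \<ge> 0" for s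
      unfolding X_def using that by (intro borel_measurable_add borel_measurable_diff Bm) auto
    have grid_pos: "0 \<le> real k * (t / Suc n)" for k n
      using t by simp
    define P where "P \<omega> \<longleftrightarrow> (\<forall>n. \<forall>k\<le>Suc n. X (real k * (t / Suc n)) \<omega> \<le> \<delta> * x)" for \<omega>
    have [measurable]: "Measurable.pred M P"
      unfolding P_def by (intro pred_intros_countable pred_all_le Xm grid_pos)
    have "AE \<omega> in M. H t \<omega> \<le> x \<longleftrightarrow> P \<omega>"
      using ae
    proof eventually_elim
      case (elim \<omega>)
      have X: "X s \<omega> = B s \<omega> + \<gamma> * s" for s
        using elim(2) by (simp add: X_def)
      have "continuous_on {0..t} (\<lambda>s. X s \<omega>)"
        unfolding X using elim(1) by (intro continuous_intros) (auto intro: continuous_on_subset)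
      from continuous_le_on_grid_iff[OF this t, of "\<delta> * x"]
      have "P \<omega> \<longleftrightarrow> (\<forall>s\<in>{0..t}. X s \<omega> \<le> \<delta> * x)"
        unfolding P_def by (rule sym)
      then show "H t \<omega> \<le> x \<longleftrightarrow> P \<omega>"
        unfolding H X using first_exit_time_le_iff[of B \<omega>, OF elim assms(2) less_imp_le[OF t] assms(4), of \<gamma>] by (simp only:)
    qed
    then have "measure M {\<omega> \<in> space M. H t \<omega> \<le> x} = measure M {\<omega> \<in> space M. P \<omega>}"
      by (intro finite_measure_eq_AE) (auto elim: eventually_mono)
    also have "\<dots> = max_cdf \<gamma> t (\<delta> * x)"
      unfolding P_def X_def using assms(2,4) by (intro drifted_brownian_max_cdf[OF BM t assms(3)]) simp
    finally show "measure M {\<omega> \<in> space M. H t \<omega> \<le> x} = max_cdf \<gamma> t (\<delta> * x)" .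
  next
    assume t: "t = 0"
    have "AE \<omega> in M. H t \<omega> \<le> x"
      using ae
    proof eventually_elim
      case (elim \<omega>)
      then show ?case
        unfolding H using first_exit_time_le_iff[of B \<omega>, OF elim assms(2) _ assms(4), of t \<gamma>] t assms(2,4) by simp
    qed
    then show "measure M {\<omega> \<in> space M. H t \<omega> \<le> x} = 1"
      by (subst prob_Collect_eq_1) auto
  }
qed

text \<open>The fundamental theorem of calculus on \<open>[x/2, 2 x]\<close>, an interval that stays away from a possible atom
at 0.\<close>

lemma (in prob_space) continuous_density_eq_deriv_cdf:
  assumes dens: "continuous_density_pos M X h"
    and cdf: "\<And>x. x > 0 \<Longrightarrow> prob {\<omega> \<in> space M. X \<omega> \<le> x} = C x"
    and C: "(C has_real_derivative D) (at x)" and "x > 0"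
  shows "h x = D"
proof -
  have [measurable]: "X \<in> borel_measurable M" and cont: "continuous_on {0<..} h"
    and pos: "\<And>x. x > 0 \<Longrightarrow> h x \<ge> 0"
    and em: "\<And>A. A \<in> sets borel \<Longrightarrow> A \<subseteq> {0<..} \<Longrightarrow> emeasure M {\<omega> \<in> space M. X \<omega> \<in> A} = (\<integral>\<^sup>+x\<in>A. ennreal (h x) \<partial>lborel)"
    using dens by (auto simp: continuous_density_pos_def)
  let ?a = "x / 2" and ?b = "2 * x"
  have contI: "continuous_on {?a..u} h" for u
    using assms(4) by (intro continuous_on_subset[OF cont]) auto
  have eq: "C u = C ?a + integral {?a..u} h" if u: "u \<in> {?a..?b}" for u
  proof -
    have int: "set_integrable lborel {?a..u} h"
      by (rule borel_integrable_compact[OF compact_Icc contI, folded set_integrable_def])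
    have "{\<omega> \<in> space M. X \<omega> \<le> u} = {\<omega> \<in> space M. X \<omega> \<le> ?a} \<union> {\<omega> \<in> space M. X \<omega> \<in> {?a<..u}}"
      using u by auto
    also have "prob \<dots> = prob {\<omega> \<in> space M. X \<omega> \<le> ?a} + prob {\<omega> \<in> space M. X \<omega> \<in> {?a<..u}}"
      by (rule finite_measure_Union) auto
    finally have "C u = C ?a + prob {\<omega> \<in> space M. X \<omega> \<in> {?a<..u}}"
      using cdf[of u] cdf[of ?a] u assms(4) by simp
    moreover have "ennreal (prob {\<omega> \<in> space M. X \<omega> \<in> {?a<..u}}) = ennreal (integral {?a..u} h)"
    proof -
      have "ennreal (prob {\<omega> \<in> space M. X \<omega> \<in> {?a<..u}}) = (\<integral>\<^sup>+x\<in>{?a<..u}. ennreal (h x) \<partial>lborel)"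
        using em[of "{?a<..u}"] assms(4) by (simp add: emeasure_eq_measure subset_eq)
      also have "\<dots> = (\<integral>\<^sup>+x. ennreal (indicator {?a..u} x *\<^sub>R h x) \<partial>lborel)"
        by (intro nn_integral_cong_AE eventually_mono[OF AE_lborel_singleton[of ?a]]) (auto simp: indicator_def)
      also have "\<dots> = ennreal (LBINT x:{?a..u}. h x)"
        unfolding set_lebesgue_integral_def using int pos assms(4)
        by (intro nn_integral_eq_integral) (auto simp: set_integrable_def indicator_def)
      also have "(LBINT x:{?a..u}. h x) = integral {?a..u} h"
        by (rule set_borel_integral_eq_integral(2)[OF int])
      finally show ?thesis .
    qed
    moreover have "0 \<le> integral {?a..u} h"
      using pos assms(4) by (intro integral_nonneg integrable_continuous_real contI) auto
    ultimately show ?thesis by simp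
  qed
  have "((\<lambda>u. integral {?a..u} h) has_real_derivative h x) (at x within {?a..?b})"
    using assms(4) by (intro integral_has_real_derivative contI) auto
  from DERIV_add[OF DERIV_const this]
  have D: "((\<lambda>u. C ?a + integral {?a..u} h) has_real_derivative h x) (at x within {?a..?b})"
    by simp
  have "(C has_real_derivative h x) (at x within {?a..?b})"
  proof (rule has_field_derivative_transform_within[OF D zero_less_one])
    show "x \<in> {?a..?b}" using assms(4) by simp
    show "C ?a + integral {?a..u} h = C u" if "u \<in> {?a..?b}" for u
      by (rule eq[OF that, symmetric])
  qed
  then have "(C has_real_derivative h x) (at x)"
    using assms(4) by (simp add: at_within_Icc_at)
  then show ?thesis
    using C by (rule DERIV_unique)
qed

lemma exit_time_density:
  assumes BM: "standard_brownian_motion M B" and "\<delta> > 0" "\<gamma> \<ge> 0" "x > 0"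
    and H: "H = first_exit_time (ig_subordinator B \<delta> \<gamma>)" and h: "continuous_density_pos M (H t) h"
  shows "t > 0 \<Longrightarrow> h x = \<delta> * max_density \<gamma> t (\<delta> * x)" and "t = 0 \<Longrightarrow> h x = 0"
proof -
  interpret prob_space M using BM by (simp add: standard_brownian_motion_def)
  have Hm: "H t \<in> borel_measurable M" using h by (simp add: continuous_density_pos_def)
  note cdf = first_exit_time_cdf[OF BM assms(2,3) _ H Hm]
  show "h x = \<delta> * max_density \<gamma> t (\<delta> * x)" if t: "t > 0"
  proof (rule continuous_density_eq_deriv_cdf[OF h cdf(1)[OF _ t] _ assms(4)])
    have "((\<lambda>x. \<delta> * x) has_real_derivative \<delta>) (at x)"
      by (auto intro!: derivative_eq_intros)
    from DERIV_chain2[OF max_cdf_deriv[OF t] this]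
    show "((\<lambda>x. max_cdf \<gamma> t (\<delta> * x)) has_real_derivative \<delta> * max_density \<gamma> t (\<delta> * x)) (at x)"
      by (simp add: mult.commute)
  qed
  show "h x = 0" if t: "t = 0"
    by (rule continuous_density_eq_deriv_cdf[OF h cdf(2)[OF _ t] _ assms(4)]) auto
qed

theorem proposition3p2:
  fixes M :: "'a measure" and B :: "real \<Rightarrow> 'a \<Rightarrow> real"
    and G :: "real \<Rightarrow> 'a \<Rightarrow> ereal" and H :: "real \<Rightarrow> 'a \<Rightarrow> real"
    and h :: "real \<Rightarrow> real \<Rightarrow> real" and \<delta> \<gamma> :: real
  assumes "\<delta> > 0" and "\<gamma> \<ge> 0"
    and "standard_brownian_motion M B"
    and "G = ig_subordinator B \<delta> \<gamma>"
    and "H = first_exit_time G"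
    and "\<And>t. t \<ge> 0 \<Longrightarrow> continuous_density_pos M (H t) (\<lambda>x. h x t)"
  shows "(\<forall>x>0. \<forall>t>0.
            (\<lambda>y. h y t) differentiable at x \<and>
            tempered_RL_differentiable (1/2) (\<gamma>\<^sup>2 / 2) (h x) t \<and>
            deriv (\<lambda>y. h y t) x
              + sqrt 2 * \<delta> * tempered_RL_deriv (1/2) (\<gamma>\<^sup>2 / 2) (h x) t = 0) \<and>
         (\<delta> = 1 \<and> \<gamma> = 0 \<longrightarrow>
           (\<forall>x>0. \<forall>t>0.
              (\<lambda>y. h y t) differentiable at x \<and>
              caputo_differentiable (1/2) (h x) t \<and>
              deriv (\<lambda>y. h y t) x
                + sqrt 2 * caputo_deriv (1/2) (h x) t
                + sqrt (2 / (pi * t)) * h x 0 = 0))"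
proof -
  have H: "H = first_exit_time (ig_subordinator B \<delta> \<gamma>)"
    using assms(4,5) by simp
  have h: "h x t = \<delta> * max_density \<gamma> t (\<delta> * x)" if "x > 0" "t > 0" for x t
    using exit_time_density(1)[OF assms(3,1,2) that(1) H assms(6)] that by simp
  have h0: "h x 0 = 0" if "x > 0" for x
    using exit_time_density(2)[OF assms(3,1,2) that(1) H assms(6)] by simp
  define D where "D x t = \<delta>\<^sup>2 * (exp (\<gamma> * (\<delta> * x) - \<gamma>\<^sup>2 * t / 2) *
      (4 * \<gamma> * heat_kernel t (\<delta> * x) - 4 * \<gamma>\<^sup>2 * heat_tail \<gamma> t (\<delta> * x) - 2 * (\<delta> * x / t) * heat_kernel t (\<delta> * x)))" for x t
  have hx: "((\<lambda>y. h y t) has_real_derivative D x t) (at x)" if x: "x > 0" and t: "t > 0" for x t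
  proof -
    have "((\<lambda>y. \<delta> * y) has_real_derivative \<delta>) (at x)"
      by (auto intro!: derivative_eq_intros)
    from DERIV_cmult[OF DERIV_chain2[OF max_density_deriv[OF t] this], of \<delta> \<gamma>]
    have "((\<lambda>y. \<delta> * max_density \<gamma> t (\<delta> * y)) has_real_derivative D x t) (at x)"
      by (rule DERIV_cong) (simp add: D_def power2_eq_square)
    moreover have "\<forall>\<^sub>F y in nhds x. h y t = \<delta> * max_density \<gamma> t (\<delta> * y)"
      using eventually_nhds_in_open[of "{0<..}" x] x t by (auto elim!: eventually_mono intro: h)
    ultimately show ?thesis
      by (subst DERIV_cong_ev[OF refl _ refl])
  qed
  have diff: "(\<lambda>y. h y t) differentiable at x" if "x > 0" "t > 0" for x t
    using hx[OF that] unfolding real_differentiable_def by blast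
  show ?thesis
  proof (intro conjI allI impI)
    fix x t :: real assume xt: "0 < x" "0 < t"
    show "(\<lambda>y. h y t) differentiable at x" by (rule diff[OF xt])
    show "tempered_RL_differentiable (1/2) (\<gamma>\<^sup>2 / 2) (h x) t"
      by (rule tempered_RL_deriv_max_density(1)[OF xt(2,1) assms(1,2) h[OF xt(1)]])
    have "sqrt 2 * \<delta> * tempered_RL_deriv (1/2) (\<gamma>\<^sup>2 / 2) (h x) t = - D x t"
      unfolding D_def by (rule tempered_RL_deriv_max_density(2)[OF xt(2,1) assms(1,2) h[OF xt(1)]])
    then show "deriv (\<lambda>y. h y t) x + sqrt 2 * \<delta> * tempered_RL_deriv (1/2) (\<gamma>\<^sup>2 / 2) (h x) t = 0"
      using DERIV_imp_deriv[OF hx[OF xt]] by linarith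
  next
    fix x t :: real assume "\<delta> = 1 \<and> \<gamma> = 0" and xt: "0 < x" "0 < t"
    then have dg: "\<delta> = 1" "\<gamma> = 0" by auto
    have hk: "h x s = 2 * heat_kernel s x" if "s > 0" for s
      using h[OF xt(1) that] by (simp add: dg max_density_def)
    show "(\<lambda>y. h y t) differentiable at x" by (rule diff[OF xt])
    show "caputo_differentiable (1/2) (h x) t"
      by (rule caputo_deriv_heat_kernel(1)[OF xt(2,1) h0[OF xt(1)] hk])
    have "caputo_deriv (1/2) (h x) t = sqrt 2 * (x / t) * heat_kernel t x"
      by (rule caputo_deriv_heat_kernel(2)[OF xt(2,1) h0[OF xt(1)] hk])
    then have "sqrt 2 * caputo_deriv (1/2) (h x) t = 2 * (x / t) * heat_kernel t x"
      by (simp add: mult.assoc[symmetric])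
    moreover have "D x t = - (2 * (x / t) * heat_kernel t x)"
      by (simp add: D_def dg)
    ultimately show "deriv (\<lambda>y. h y t) x + sqrt 2 * caputo_deriv (1/2) (h x) t + sqrt (2 / (pi * t)) * h x 0 = 0"
      using DERIV_imp_deriv[OF hx[OF xt]] by (simp add: h0[OF xt(1)])
  qed
qed

end
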